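(* Let $\theta\in(0,1]$ and let $\mathbb{T}\colon\mathcal{H}\to\mathcal{H}$ be $\theta$-averaged with respect to $\|\cdot\|_M$, with infimal displacement vector $\mathbf{v}$. Let $\mathcal{I}^0,\mathcal{I}^1,\ldots$ be IID random vectors in $[0,1]^m$ whose common distribution (that of $\mathcal{I}$) satisfies $\mathbb{E}[\mathcal{I}]=\alpha\mathbf{1}$ with some $\alpha\in(0,1]$, and assume that $\beta>0$ satisfies $\beta<\alpha/\theta$ and $$\mathbb{E}_{\mathcal{I}}\left[\|u_{\mathcal{I}}\|_M^2\right]\le\beta\|u\|_M^2\qquad\text{for all }u\in\mathcal{H}.$$ Let $x^0\in\mathcal{H}$ and $x^{k+1}=\mathbb{T}_{\mathcal{I}^k}x^k$ for $k=0,1,2,\dots$. (a) If $\mathbf{v}\in\mathrm{range}(\mathrm{Id}-\mathbb{T})$, then $$\limsup_{k\to\infty}\;k\,\mathbb{E}\left[\left\|\frac{x^k}{k}+\alpha\mathbf{v}\right\|_M^2\right]\le(\beta-\alpha^2)\|\mathbf{v}\|_M^2 .$$ (b) In general, regardless of whether $\mathbf{v}$ is in $\mathrm{range}(\mathrm{Id}-\mathbb{T})$ or not, $$\limsup_{k\to\infty}\;k\,\mathrm{Var}_M\left(\frac{x^k}{k}\right)\le(\beta-\alpha^2)\|\mathbf{v}\|_M^2 .$$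
   Context: $\mathcal{H}=\mathcal{H}_1\oplus\cdots\oplus\mathcal{H}_m$ is a direct sum of real Hilbert spaces, with $\langle x,y\rangle=\sum_{i=1}^m\langle x_i,y_i\rangle_i$, where $x_i\in\mathcal{H}_i$ is the $i$th block of $x$. $M\colon\mathcal{H}\to\mathcal{H}$ is a bounded, linear, self-adjoint, positive definite operator; $\langle x,y\rangle_M=\langle x,My\rangle$ and $\|x\|_M=\sqrt{\langle x,Mx\rangle}$, and $\mathcal{H}$ with $\langle\cdot,\cdot\rangle_M$ is again a Hilbert space. $\mathrm{Id}$ is the identity operator. For an $\mathcal{H}$-valued random variable $X$, $\mathrm{Var}_M[X]=\mathbb{E}[\|X\|_M^2]-\|\mathbb{E}[X]\|_M^2$. An operator $\mathbb{T}$ is $\theta$-averaged with respect to a norm, $\theta\in(0,1]$, if $\mathbb{T}=(1-\theta)\mathrm{Id}+\theta\mathbb{C}$ for some operator $\mathbb{C}$ that is non-expansive (1-Lipschitz) in that norm; for $\theta=1$ this just means $\mathbb{T}$ is non-expansive. Put $\mathbb{S}=\theta^{-1}(\mathrm{Id}-\mathbb{T})$ and $\mathbb{S}_ix=(0,\dots,0,(\mathbb{S}x)_i,0,\dots,0)$ (only the $i$th block kept). For a selection vector $\mathcal{I}=(\mathcal{I}_1,\dots,\mathcal{I}_m)\in[0,1]^m$ put $\mathbb{S}_{\mathcal{I}}=\sum_{i=1}^m\mathcal{I}_i\mathbb{S}_i$, $\mathbb{T}_{\mathcal{I}}=\mathrm{Id}-\theta\mathbb{S}_{\mathcal{I}}$,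 and, for $u\in\mathcal{H}$, $u_{\mathcal{I}}=\sum_{i=1}^m\mathcal{I}_i(0,\dots,0,u_i,0,\dots,0)$. $\mathbf{1}\in\mathbb{R}^m$ is the all-ones vector. The infimal displacement vector $\mathbf{v}$ of $\mathbb{T}$ is the unique minimum-$M$-norm element of the nonempty closed convex set $\overline{\mathrm{range}(\mathrm{Id}-\mathbb{T})}$. The starting point $x^0$ is deterministic. *)

theory Defs
  imports "HOL-Probability.Probability"
begin

(* The library has no direct sum of Hilbert spaces of different types, so the direct sum
   H = H_1 + ... + H_m is rendered internally: H is a complete real inner product space and the
   i-th summand is the closed subspace H i of vectors whose blocks other than the i-th vanish.
   Every external Hilbert direct sum is of this form, and the inner product of H is then the sum
   of the inner products of the blocks. The index set is a finite type 'm with CARD('m) = m. *)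
definition hilbert_direct_sum :: "('m::finite \<Rightarrow> 'a::{real_inner, complete_space} set) \<Rightarrow> bool" where
  "hilbert_direct_sum H \<longleftrightarrow>
     (\<forall>i. subspace (H i) \<and> closed (H i)) \<and>
     (\<forall>i j. i \<noteq> j \<longrightarrow> (\<forall>x\<in>H i. \<forall>y\<in>H j. inner x y = 0)) \<and>
     (\<forall>x. \<exists>f. (\<forall>i. f i \<in> H i) \<and> x = (\<Sum>i\<in>UNIV. f i))"

(* block H i x is (0, ..., 0, x_i, 0, ..., 0) *)
definition block :: "('m::finite \<Rightarrow> 'a::{real_inner, complete_space} set) \<Rightarrow> 'm \<Rightarrow> 'a \<Rightarrow> 'a" where
  "block H i x = (THE f. (\<forall>j. f j \<in> H j) \<and> x = (\<Sum>j\<in>UNIV. f j)) i"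

(* u_I for a selection vector I *)
definition select :: "('m::finite \<Rightarrow> 'a::{real_inner, complete_space} set) \<Rightarrow> real ^ 'm \<Rightarrow> 'a \<Rightarrow> 'a" where
  "select H s u = (\<Sum>i\<in>UNIV. (s $ i) *\<^sub>R block H i u)"

definition inner_M :: "('a::real_inner \<Rightarrow> 'a) \<Rightarrow> 'a \<Rightarrow> 'a \<Rightarrow> real" where
  "inner_M M x y = inner x (M y)"

definition norm_M :: "('a::real_inner \<Rightarrow> 'a) \<Rightarrow> 'a \<Rightarrow> real" where
  "norm_M M x = sqrt (inner_M M x x)"

(* In infinite dimension, strict positivity alone does not make H complete for the M-norm;
   completeness is therefore part of the definition. *)
definition hilbert_metric :: "('a::{real_inner, complete_space} \<Rightarrow> 'a) \<Rightarrow> bool" where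
  "hilbert_metric M \<longleftrightarrow>
     bounded_linear M \<and>
     (\<forall>x y. inner (M x) y = inner x (M y)) \<and>
     (\<forall>x. x \<noteq> 0 \<longrightarrow> inner x (M x) > 0) \<and>
     (\<forall>X :: nat \<Rightarrow> 'a. (\<forall>e>0. \<exists>N. \<forall>p\<ge>N. \<forall>q\<ge>N. norm_M M (X p - X q) < e) \<longrightarrow>
        (\<exists>l. (\<lambda>n. norm_M M (X n - l)) \<longlonglongrightarrow> 0))"

definition nonexpansive :: "('a::real_inner \<Rightarrow> 'a) \<Rightarrow> ('a \<Rightarrow> 'a) \<Rightarrow> bool" where
  "nonexpansive M C \<longleftrightarrow> (\<forall>x y. norm_M M (C x - C y) \<le> norm_M M (x - y))"

definition averaged :: "('a::real_inner \<Rightarrow> 'a) \<Rightarrow> real \<Rightarrow> ('a \<Rightarrow> 'a) \<Rightarrow> bool" where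
  "averaged M \<theta> T \<longleftrightarrow>
     (\<exists>C. nonexpansive M C \<and> (\<forall>x. T x = (1 - \<theta>) *\<^sub>R x + \<theta> *\<^sub>R C x))"

definition infimal_displacement :: "('a::real_inner \<Rightarrow> 'a) \<Rightarrow> ('a \<Rightarrow> 'a) \<Rightarrow> 'a \<Rightarrow> bool" where
  "infimal_displacement M T v \<longleftrightarrow>
     v \<in> closure (range (\<lambda>x. x - T x)) \<and>
     (\<forall>w \<in> closure (range (\<lambda>x. x - T x)). norm_M M v \<le> norm_M M w)"

definition S_op :: "real \<Rightarrow> ('a::real_vector \<Rightarrow> 'a) \<Rightarrow> 'a \<Rightarrow> 'a" where
  "S_op \<theta> T x = (1 / \<theta>) *\<^sub>R (x - T x)"

definition S_block ::
  "('m::finite \<Rightarrow> 'a::{real_inner, complete_space} set) \<Rightarrow> real \<Rightarrow> ('a \<Rightarrow> 'a) \<Rightarrow> 'm \<Rightarrow> 'a \<Rightarrow> 'a" where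
  "S_block H \<theta> T i x = block H i (S_op \<theta> T x)"

definition S_select ::
  "('m::finite \<Rightarrow> 'a::{real_inner, complete_space} set) \<Rightarrow> real \<Rightarrow> ('a \<Rightarrow> 'a) \<Rightarrow> real ^ 'm \<Rightarrow> 'a \<Rightarrow> 'a" where
  "S_select H \<theta> T s x = (\<Sum>i\<in>UNIV. (s $ i) *\<^sub>R S_block H \<theta> T i x)"

definition T_select ::
  "('m::finite \<Rightarrow> 'a::{real_inner, complete_space} set) \<Rightarrow> real \<Rightarrow> ('a \<Rightarrow> 'a) \<Rightarrow> real ^ 'm \<Rightarrow> 'a \<Rightarrow> 'a" where
  "T_select H \<theta> T s x = x - \<theta> *\<^sub>R S_select H \<theta> T s x"

primrec iterate ::
  "('m::finite \<Rightarrow> 'a::{real_inner, complete_space} set) \<Rightarrow> real \<Rightarrow> ('a \<Rightarrow> 'a) \<Rightarrow>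
   (nat \<Rightarrow> 'w \<Rightarrow> real ^ 'm) \<Rightarrow> 'a \<Rightarrow> nat \<Rightarrow> 'w \<Rightarrow> 'a" where
  "iterate H \<theta> T I x0 0 \<omega> = x0"
| "iterate H \<theta> T I x0 (Suc k) \<omega> = T_select H \<theta> T (I k \<omega>) (iterate H \<theta> T I x0 k \<omega>)"

(* The library's Bochner integral requires a second countable codomain, which would force H to be
   separable. This is has_bochner_integral with that class constraint dropped. *)
definition has_expectation :: "'w measure \<Rightarrow> ('w \<Rightarrow> 'a::real_normed_vector) \<Rightarrow> 'a \<Rightarrow> bool" where
  "has_expectation P X e \<longleftrightarrow>
     X \<in> borel_measurable P \<and>
     (\<exists>s :: nat \<Rightarrow> 'w \<Rightarrow> 'a.
        (\<forall>n. Bochner_Integration.simple_bochner_integrable P (s n)) \<and>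
        (\<lambda>n. \<integral>\<^sup>+\<omega>. norm (X \<omega> - s n \<omega>) \<partial>P) \<longlonglongrightarrow> 0 \<and>
        (\<lambda>n. Bochner_Integration.simple_bochner_integral P (s n)) \<longlonglongrightarrow> e)"

definition expected :: "'w measure \<Rightarrow> ('w \<Rightarrow> 'a::real_normed_vector) \<Rightarrow> 'a" where
  "expected P X = (THE e. has_expectation P X e)"

definition Var_M :: "('a::real_inner \<Rightarrow> 'a) \<Rightarrow> 'w measure \<Rightarrow> ('w \<Rightarrow> 'a) \<Rightarrow> real" where
  "Var_M M P X = (\<integral>\<omega>. (norm_M M (X \<omega>))\<^sup>2 \<partial>P) - (norm_M M (expected P X))\<^sup>2"

end

theory Submission
  imports Defs "HOL-Real_Asymp.Real_Asymp"
begin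

text \<open>
  Write \<open>disp x = x - T x\<close>. Averagedness of \<open>T\<close> is cocoercivity of \<open>disp\<close> in the \<open>M\<close>-inner product
  \<open>ip\<close> (lemma \<open>cocoercive\<close>). A random step replaces \<open>x\<close> by \<open>x - select H s (disp x)\<close>, with mean
  \<open>G x = x - \<alpha> disp x\<close>.

  The random iterates \<open>X k\<close> are compared with the deterministic trajectory \<open>(G ^^ k) z\<close>, moved by a
  fixed multiple \<open>offset\<close> of \<open>v\<close>. With \<open>c = \<beta> - \<alpha>\<^sup>2\<close>, taking the mean over \<open>s\<close> shows that the mean squared
  \<open>M\<close>-distance grows in one step by at most \<open>c (nM (disp z))\<^sup>2\<close> plus a multiple of
  \<open>(nM (disp z - v))\<^sup>2\<close> (lemma \<open>one_step\<close>). The difference of the displacements at the random and at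
  the reference point enters this estimate in a negative square, with coefficient
  \<open>\<beta> - \<alpha> / \<theta>\<close>, and in a linear term \<open>2 c ip (disp z) (disp x - disp z)\<close>. The part \<open>2 c ip v (disp x - disp z)\<close>
  of the latter does not become small, but it is \<open>2 c / \<alpha>\<close> times the decrease of the mean of
  \<open>ip v (x - z)\<close>; the choice of \<open>offset\<close> completes the square and removes it. The rest is absorbed by
  the negative square.

  Along the reference trajectory \<open>disp ((G ^^ k) z)\<close> tends to \<open>v\<close> (lemma \<open>disp_reference_tendsto\<close>), so
  the growth per step tends to \<open>c (nM v)\<^sup>2\<close>, and the Cesaro mean of these bounds is the claimed rate.
  The variance is at most the mean squared distance to any fixed vector, which gives the second claim.
  If \<open>v = disp z\<close>, the reference trajectory is \<open>z - k \<alpha> v\<close>, which gives the first.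

  The convergence to \<open>v\<close> rests on the inequality \<open>0 \<le> ip v (disp x - v)\<close> (lemma \<open>variational\<close>),
  obtained from approximate solutions of \<open>(1 + \<mu>) z = T z\<close> for \<open>\<mu> \<rightarrow> 0\<close>. Expectations require that the iterates
  are measurable for the topology of the original norm. This holds because the original norm and the
  \<open>M\<close>-norm are equivalent (lemmas \<open>nM_le_norm\<close> and \<open>norm_le_nM\<close>), so that \<open>T\<close> is continuous and the
  iterates are continuous functions of the selection vectors.
\<close>

section \<open>The geometry of the metric\<close>

locale metric_operator =
  fixes M :: "'a::{real_inner, complete_space} \<Rightarrow> 'a"
  assumes metric: "hilbert_metric M"
begin

lemma bounded_linear_M: "bounded_linear M"
  and M_selfadjoint: "inner (M x) y = inner x (M y)"
  and M_pos: "x \<noteq> 0 \<Longrightarrow> inner x (M x) > 0"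
  and M_complete: "(\<And>e. e > 0 \<Longrightarrow> \<exists>N. \<forall>p\<ge>N. \<forall>q\<ge>N. norm_M M (X p - X q) < e) \<Longrightarrow>
        (\<exists>l. (\<lambda>n. norm_M M (X n - l)) \<longlonglongrightarrow> 0)"
  using metric unfolding hilbert_metric_def by blast+

lemmas M_add = linear_add[OF bounded_linear.linear[OF bounded_linear_M]]
  and M_diff = linear_diff[OF bounded_linear.linear[OF bounded_linear_M]]
  and M_scaleR = linear_scale[OF bounded_linear.linear[OF bounded_linear_M]]
  and M_zero = linear_0[OF bounded_linear.linear[OF bounded_linear_M]]
  and M_sum = linear_sum[OF bounded_linear.linear[OF bounded_linear_M]]
  and M_minus = linear_neg[OF bounded_linear.linear[OF bounded_linear_M]]

abbreviation ip :: "'a \<Rightarrow> 'a \<Rightarrow> real" where "ip \<equiv> inner_M M"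
abbreviation nM :: "'a \<Rightarrow> real" where "nM \<equiv> norm_M M"

lemma ip_commute: "ip x y = ip y x"
  unfolding inner_M_def by (metis M_selfadjoint inner_commute)

lemma ip_simps:
  "ip (x + y) z = ip x z + ip y z" "ip z (x + y) = ip z x + ip z y"
  "ip (x - y) z = ip x z - ip y z" "ip z (x - y) = ip z x - ip z y"
  "ip (r *\<^sub>R x) z = r * ip x z" "ip z (r *\<^sub>R x) = r * ip z x"
  "ip (- x) z = - ip x z" "ip z (- x) = - ip z x"
  "ip 0 z = 0" "ip z 0 = 0"
  unfolding inner_M_def
  by (simp_all add: M_add M_diff M_scaleR M_zero M_minus inner_add inner_diff)

lemma ip_sum_left: "ip (\<Sum>i\<in>A. f i) z = (\<Sum>i\<in>A. ip (f i) z)"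
  and ip_sum_right: "ip z (\<Sum>i\<in>A. f i) = (\<Sum>i\<in>A. ip z (f i))"
  unfolding inner_M_def by (simp_all add: M_sum inner_sum_left inner_sum_right)

lemma ip_self_nonneg [simp]: "0 \<le> ip x x"
  using M_pos[of x] unfolding inner_M_def by (cases "x = 0") auto

lemma nM_nonneg [simp]: "0 \<le> nM x"
  unfolding norm_M_def by simp

lemma nM_sq: "(nM x)\<^sup>2 = ip x x"
  unfolding norm_M_def by simp

lemma nM_0 [simp]: "nM 0 = 0"
  unfolding norm_M_def by (simp add: ip_simps)

lemma nM_eq_0_iff [simp]: "nM x = 0 \<longleftrightarrow> x = 0"
  using M_pos[of x] unfolding norm_M_def inner_M_def by (cases "x = 0") (auto simp: M_zero)

lemma nM_scaleR: "nM (r *\<^sub>R x) = \<bar>r\<bar> * nM x"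
  unfolding norm_M_def by (simp add: ip_simps real_sqrt_mult real_sqrt_abs2 flip: mult.assoc)

lemma nM_minus_commute: "nM (x - y) = nM (y - x)"
  unfolding norm_M_def by (simp add: ip_simps algebra_simps)

lemma ip_le_nM: "ip x y \<le> nM x * nM y"
proof (cases "x = 0 \<or> y = 0")
  case True
  then show ?thesis by (auto simp: ip_simps)
next
  case False
  then have pos: "nM x > 0" "nM y > 0"
    by (simp_all add: order_less_le)
  have "0 \<le> ip (nM y *\<^sub>R x - nM x *\<^sub>R y) (nM y *\<^sub>R x - nM x *\<^sub>R y)"
    by simp
  also have "\<dots> = 2 * (nM x * nM y) * (nM x * nM y - ip x y)"
    by (simp only: ip_simps ip_commute[of y x] nM_sq[of x, symmetric] nM_sq[of y, symmetric])
       (simp add: algebra_simps power2_eq_square)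
  finally show ?thesis
    using mult_pos_pos[OF pos] by (simp add: zero_le_mult_iff)
qed

lemma abs_ip_le_nM: "\<bar>ip x y\<bar> \<le> nM x * nM y"
  using ip_le_nM[of x y] ip_le_nM[of "-x" y] nM_scaleR[of "-1" x] by (simp add: ip_simps)

lemma nM_sq_add: "(nM (x + y))\<^sup>2 = (nM x)\<^sup>2 + 2 * ip x y + (nM y)\<^sup>2"
  and nM_sq_diff: "(nM (x - y))\<^sup>2 = (nM x)\<^sup>2 - 2 * ip x y + (nM y)\<^sup>2"
  unfolding nM_sq by (simp_all add: ip_simps ip_commute[of y x] algebra_simps)

lemma nM_triangle: "nM (x + y) \<le> nM x + nM y"
proof (rule power2_le_imp_le)
  show "(nM (x + y))\<^sup>2 \<le> (nM x + nM y)\<^sup>2"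
    using ip_le_nM[of x y] by (simp add: nM_sq_add power2_sum)
qed simp

lemma nM_triangle_diff: "nM (x - z) \<le> nM (x - y) + nM (y - z)"
  using nM_triangle[of "x - y" "y - z"] by simp

lemma nM_sq_add_le:
  assumes "\<epsilon> > 0"
  shows "(nM (x + y))\<^sup>2 \<le> (1 + \<epsilon>) * (nM x)\<^sup>2 + (1 + 1 / \<epsilon>) * (nM y)\<^sup>2"
proof -
  have "0 \<le> (1 / \<epsilon>) * (nM (\<epsilon> *\<^sub>R x - y))\<^sup>2"
    using assms by (intro mult_nonneg_nonneg) auto
  also have "\<dots> = \<epsilon> * (nM x)\<^sup>2 - 2 * ip x y + (1 / \<epsilon>) * (nM y)\<^sup>2"
    unfolding nM_sq_diff[of "\<epsilon> *\<^sub>R x"] nM_scaleR ip_simps(5)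
    using assms by (simp add: power_mult_distrib power2_eq_square field_simps)
  finally show ?thesis
    by (simp add: nM_sq_add algebra_simps)
qed

lemma bounded_bilinear_ip: "bounded_bilinear ip"
  unfolding inner_M_def
  by (rule bounded_bilinear.comp[OF bounded_bilinear_inner bounded_linear_ident bounded_linear_M])

lemma nM_le_norm: "\<exists>K>0. \<forall>x. nM x \<le> K * norm x"
proof -
  obtain K where K: "K > 0" "\<And>x y. norm (ip x y) \<le> norm x * norm y * K"
    using bounded_bilinear.pos_bounded[OF bounded_bilinear_ip] by blast
  have "nM x \<le> sqrt K * norm x" for x
  proof (rule power2_le_imp_le)
    show "(nM x)\<^sup>2 \<le> (sqrt K * norm x)\<^sup>2"
      using K(2)[of x x] K(1) unfolding nM_sq by (simp add: power_mult_distrib power2_norm_eq_inner) (simp add: power2_eq_square mult_ac flip: power2_norm_eq_inner)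
  qed (use K in simp)
  then show ?thesis
    using K(1) by (intro exI[of _ "sqrt K"]) auto
qed

lemma continuous_on_ip [continuous_intros]:
  "continuous_on S f \<Longrightarrow> continuous_on S g \<Longrightarrow> continuous_on S (\<lambda>s. ip (f s) (g s))"
  by (rule bounded_bilinear.continuous_on[OF bounded_bilinear_ip])

lemma continuous_on_nM [continuous_intros]:
  "continuous_on S f \<Longrightarrow> continuous_on S (\<lambda>s. nM (f s))"
  unfolding norm_M_def by (intro continuous_intros)

lemma tendsto_nM_of_tendsto: "f \<longlonglongrightarrow> l \<Longrightarrow> (\<lambda>n. nM (f n)) \<longlonglongrightarrow> nM l"
  unfolding norm_M_def by (intro tendsto_real_sqrt bounded_bilinear.tendsto[OF bounded_bilinear_ip])

text \<open>This is the uniform boundedness principle on the Hilbert space with the \<open>M\<close>-inner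
  product, for the functionals \<open>x \<mapsto> ip x h\<close> with \<open>norm (M h) \<le> 1\<close>: they are
  pointwise bounded since \<open>ip x h = inner x (M h)\<close>. If their norms \<open>nM h\<close> were unbounded,
  a gliding hump \<open>X 0, X 1, \<dots>\<close> with steps of length at most \<open>(1/3) ^ n\<close> would converge in the
  \<open>M\<close>-norm to a point where they are unbounded.\<close>

lemma nM_le_norm_M: "\<exists>C>0. \<forall>h. nM h \<le> C * norm (M h)"
proof (rule ccontr)
  assume neg: "\<not> ?thesis"
  have "\<exists>h. norm (M h) \<le> 1 \<and> 4 ^ n \<le> nM h" for n :: nat
  proof -
    obtain h where h: "4 ^ n * norm (M h) < nM h"
      using neg by (metis not_le zero_less_numeral zero_less_power)
    then have "h \<noteq> 0" by (auto simp: M_zero)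
    then have Mh: "norm (M h) > 0"
      using M_pos[of h] by auto
    show ?thesis
    proof (intro exI conjI)
      show "norm (M ((1 / norm (M h)) *\<^sub>R h)) \<le> 1"
        using Mh by (simp add: M_scaleR)
      show "4 ^ n \<le> nM ((1 / norm (M h)) *\<^sub>R h)"
        using Mh h by (simp add: nM_scaleR field_simps)
    qed
  qed
  then obtain h where h: "\<And>n. norm (M (h n)) \<le> 1" "\<And>n. 4 ^ n \<le> nM (h n)"
    by metis
  have hpos: "nM (h n) > 0" for n
    using h(2)[of n] by (rule order_less_le_trans[rotated]) simp
  \<comment> \<open>one of the two points at distance \<open>(1/3) ^ n\<close> from \<open>x\<close> in the direction of \<open>h n\<close>
      has a large inner product with \<open>h n\<close>\<close>
  have step: "\<exists>y. nM (y - x) \<le> (1/3) ^ n \<and> (1/3) ^ n * nM (h n) \<le> \<bar>ip y (h n)\<bar>" for n :: nat and x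
  proof -
    define d where "d = ((1/3) ^ n / nM (h n)) *\<^sub>R h n"
    have d: "nM d = (1/3) ^ n" "ip d (h n) = (1/3) ^ n * nM (h n)"
      using hpos[of n] by (simp_all add: d_def nM_scaleR ip_simps nM_sq[symmetric] power2_eq_square less_imp_neq[symmetric] del: nM_eq_0_iff)
    have "(1/3) ^ n * nM (h n) \<le> \<bar>ip (x + d) (h n)\<bar> \<or> (1/3) ^ n * nM (h n) \<le> \<bar>ip (x - d) (h n)\<bar>"
      unfolding ip_simps d(2) using hpos[of n] by linarith
    moreover have "nM ((x + d) - x) = (1/3) ^ n" "nM ((x - d) - x) = (1/3) ^ n"
      using d(1) nM_minus_commute[of "x - d" x] by simp_all
    ultimately show ?thesis
      by (metis order_refl)
  qed
  obtain g where g: "\<And>n x. nM (g n x - x) \<le> (1/3) ^ n"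
    "\<And>n x. (1/3) ^ n * nM (h n) \<le> \<bar>ip (g n x) (h n)\<bar>"
  proof -
    from step have "\<forall>n x. \<exists>y. nM (y - x) \<le> (1/3) ^ n \<and> (1/3) ^ n * nM (h n) \<le> \<bar>ip y (h n)\<bar>"
      by blast
    then show thesis
      by (auto simp only: choice_iff intro: that)
  qed
  define X where "X = rec_nat 0 (\<lambda>n x. g (Suc n) x)"
  have X: "nM (X (Suc n) - X n) \<le> (1/3) ^ Suc n"
    "(1/3) ^ Suc n * nM (h (Suc n)) \<le> \<bar>ip (X (Suc n)) (h (Suc n))\<bar>" for n
    using g by (simp_all add: X_def del: power_Suc)
  have dist: "nM (X (n + m) - X n) \<le> (1/2) * (1/3) ^ n * (1 - (1/3) ^ m)" for n m
  proof (induction m)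
    case (Suc m)
    have "nM (X (n + Suc m) - X n) \<le> nM (X (Suc (n + m)) - X (n + m)) + nM (X (n + m) - X n)"
      using nM_triangle_diff by simp
    also have "\<dots> \<le> (1/3) ^ Suc (n + m) + (1/2) * (1/3) ^ n * (1 - (1/3) ^ m)"
      using X(1)[of "n + m"] Suc.IH by linarith
    also have "\<dots> = (1/2) * (1/3) ^ n * (1 - (1/3) ^ Suc m)"
      by (simp add: power_add field_simps)
    finally show ?case .
  qed simp
  have dist': "nM (X p - X n) \<le> (1/2) * (1/3) ^ n" if "n \<le> p" for n p
  proof -
    have "nM (X p - X n) \<le> (1/2) * (1/3) ^ n * (1 - (1/3) ^ (p - n))"
      using dist[of n "p - n"] that by simp
    also have "\<dots> \<le> (1/2) * (1/3) ^ n * 1"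
      by (intro mult_left_mono) simp_all
    finally show ?thesis by simp
  qed
  have "\<exists>N. \<forall>p\<ge>N. \<forall>q\<ge>N. nM (X p - X q) < e" if "e > 0" for e
  proof -
    obtain N where N: "(1/3::real) ^ N < e"
      using real_arch_pow_inv[of e "1/3"] \<open>e > 0\<close> by auto
    show ?thesis
    proof (intro exI allI impI)
      fix p q assume "N \<le> p" "N \<le> q"
      then have "nM (X p - X N) \<le> (1/2) * (1/3) ^ N" "nM (X q - X N) \<le> (1/2) * (1/3) ^ N"
        using dist'[of N p] dist'[of N q] by simp_all
      then show "nM (X p - X q) < e"
        using nM_triangle_diff[of "X p" "X q" "X N"] nM_minus_commute[of "X N" "X q"] N by linarith
    qed
  qed
  then obtain l where l: "(\<lambda>n. nM (X n - l)) \<longlonglongrightarrow> 0"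
    using M_complete by blast
  have lim: "nM (l - X n) \<le> (1/2) * (1/3) ^ n" for n
  proof (rule tendsto_lowerbound)
    show "(\<lambda>p. nM (X p - l) + (1/2) * (1/3) ^ n) \<longlonglongrightarrow> (1/2) * (1/3) ^ n"
      using tendsto_add[OF l tendsto_const] by simp
    show "\<forall>\<^sub>F p in sequentially. nM (l - X n) \<le> nM (X p - l) + (1/2) * (1/3) ^ n"
      using eventually_ge_at_top[of n]
    proof eventually_elim
      case (elim p)
      then show ?case
        using nM_triangle_diff[of l "X n" "X p"] nM_minus_commute[of l "X p"] dist'[of n p] by linarith
    qed
  qed simp
  have low: "(1/2) * (4/3) ^ Suc n \<le> norm l" for n
  proof -
    have "\<bar>ip (l - X (Suc n)) (h (Suc n))\<bar> \<le> (1/2) * (1/3) ^ Suc n * nM (h (Suc n))"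
      by (rule order_trans[OF abs_ip_le_nM]) (intro mult_right_mono lim nM_nonneg)
    then have "(1/2) * (1/3) ^ Suc n * nM (h (Suc n)) \<le> \<bar>ip l (h (Suc n))\<bar>"
      using X(2)[of n] unfolding ip_simps by linarith
    also have "\<dots> \<le> norm l * norm (M (h (Suc n)))"
      unfolding inner_M_def by (rule Cauchy_Schwarz_ineq2)
    also have "\<dots> \<le> norm l"
      using h(1)[of "Suc n"] by (simp add: mult_left_le)
    finally have "(1/2) * (1/3) ^ Suc n * nM (h (Suc n)) \<le> norm l" .
    moreover have "(1/2) * (1/3::real) ^ Suc n * 4 ^ Suc n \<le> (1/2) * (1/3) ^ Suc n * nM (h (Suc n))"
      by (intro mult_left_mono h) simp
    moreover have "(1/3::real) ^ Suc n * 4 ^ Suc n = (4/3) ^ Suc n"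
      by (simp flip: power_mult_distrib)
    ultimately show ?thesis by (simp only: mult.assoc)
  qed
  obtain n where n: "2 * norm l < (4/3) ^ n"
    using real_arch_pow[of "4/3"] by auto
  also have "(4/3::real) ^ n \<le> (4/3) ^ Suc n"
    by (rule power_increasing) simp_all
  finally show False
    using low[of n] by linarith
qed

text \<open>By the previous bound, the Richardson iteration \<open>r \<mapsto> r - t M r\<close> contracts the
  \<open>M\<close>-norm for small \<open>t > 0\<close>. Hence \<open>x = t \<Sum>j. M (r j)\<close> for the residuals \<open>r j\<close> started at
  \<open>x\<close>, and \<open>norm (M (r j))\<close> is bounded by a multiple of \<open>nM (r j)\<close>.\<close>

lemma norm_le_nM: "\<exists>C>0. \<forall>x. norm x \<le> C * nM x"
proof -
  obtain K where K: "K > 0" "\<And>x. nM x \<le> K * norm x"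
    using nM_le_norm by blast
  obtain C where C: "C > 0" "\<And>h. nM h \<le> C * norm (M h)"
    using nM_le_norm_M by blast
  have MK: "norm (M x) \<le> K * nM x" for x
  proof (cases "M x = 0")
    case False
    have "norm (M x) * norm (M x) = ip (M x) x"
      by (simp add: inner_M_def power2_norm_eq_inner flip: power2_eq_square)
    also have "\<dots> \<le> nM (M x) * nM x"
      by (rule ip_le_nM)
    also have "\<dots> \<le> (K * norm (M x)) * nM x"
      by (intro mult_right_mono K) simp
    finally have "norm (M x) * norm (M x) \<le> norm (M x) * (K * nM x)"
      by (simp add: mult_ac)
    then show ?thesis using False by simp
  qed (use K(1) in simp)
  define t where "t = min (1 / K\<^sup>2) (C\<^sup>2)"
  define q where "q = sqrt (1 - t / C\<^sup>2)"
  have t: "t > 0" "t * K\<^sup>2 \<le> 1" "t \<le> C\<^sup>2"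
    using K(1) C(1) by (auto simp: t_def min_def field_simps)
  have q: "0 \<le> q" "q < 1" "q\<^sup>2 = 1 - t / C\<^sup>2"
    using t C(1) by (auto simp: q_def)
  have contract: "nM (r - t *\<^sub>R M r) \<le> q * nM r" for r
  proof (rule power2_le_imp_le)
    have 1: "(nM r)\<^sup>2 / C\<^sup>2 \<le> (norm (M r))\<^sup>2"
      using power_mono[OF C(2)[of r], of 2] C(1) by (simp add: field_simps)
    have "t\<^sup>2 * (nM (M r))\<^sup>2 \<le> t\<^sup>2 * (K * norm (M r))\<^sup>2"
      by (intro mult_left_mono power_mono K) auto
    also have "\<dots> = (t * K\<^sup>2) * (t * (norm (M r))\<^sup>2)"
      by (simp add: power_mult_distrib power2_eq_square mult_ac)
    also have "\<dots> \<le> 1 * (t * (norm (M r))\<^sup>2)"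
      using t by (intro mult_right_mono) auto
    finally have 2: "t\<^sup>2 * (nM (M r))\<^sup>2 \<le> t * (norm (M r))\<^sup>2" by simp
    have 3: "ip r (M r) = (norm (M r))\<^sup>2"
      by (simp add: inner_M_def power2_norm_eq_inner flip: M_selfadjoint)
    have "(nM (r - t *\<^sub>R M r))\<^sup>2 = (nM r)\<^sup>2 - 2 * t * (norm (M r))\<^sup>2 + t\<^sup>2 * (nM (M r))\<^sup>2"
      by (simp add: nM_sq_diff ip_simps 3 nM_scaleR power_mult_distrib)
    also have "\<dots> \<le> (nM r)\<^sup>2 - t * (norm (M r))\<^sup>2"
      using 2 by linarith
    also have "\<dots> \<le> (nM r)\<^sup>2 - t * ((nM r)\<^sup>2 / C\<^sup>2)"
      using mult_left_mono[OF 1, of t] t by linarith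
    also have "\<dots> = (q * nM r)\<^sup>2"
      by (simp add: power_mult_distrib q algebra_simps)
    finally show "(nM (r - t *\<^sub>R M r))\<^sup>2 \<le> (q * nM r)\<^sup>2" .
  qed (use q in simp)
  have bound: "norm x \<le> t * K / (1 - q) * nM x" for x
  proof -
    define r where "r n = ((\<lambda>r. r - t *\<^sub>R M r) ^^ n) x" for n
    have r_Suc: "r (Suc n) = r n - t *\<^sub>R M (r n)" for n
      by (simp add: r_def)
    have rq: "nM (r n) \<le> q ^ n * nM x" for n
    proof (induction n)
      case (Suc n)
      have "nM (r (Suc n)) \<le> q * nM (r n)"
        unfolding r_Suc by (rule contract)
      also have "\<dots> \<le> q * (q ^ n * nM x)"
        using q by (intro mult_left_mono Suc.IH) auto
      finally show ?case by simp
    qed (simp add: r_def)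
    have Mr: "norm (M (r n)) \<le> K * nM x * q ^ n" for n
    proof -
      have "norm (M (r n)) \<le> K * nM (r n)" by (rule MK)
      also have "\<dots> \<le> K * (q ^ n * nM x)"
        using K(1) by (intro mult_left_mono rq) auto
      finally show ?thesis by (simp add: mult_ac)
    qed
    have geo: "(\<lambda>n. K * nM x * q ^ n) sums (K * nM x * (1 / (1 - q)))"
      using q by (intro sums_mult geometric_sums) auto
    then have summ: "summable (\<lambda>n. norm (M (r n)))"
      by (intro summable_comparison_test[OF _ sums_summable[OF geo]]) (use Mr in auto)
    have step: "norm (r (m + k) - r m) \<le> t * (\<Sum>j\<in>{m..<m+k}. norm (M (r j)))" for m k
    proof (induction k)
      case (Suc k)
      have "norm (r (m + Suc k) - r m) \<le> norm (r (m + k) - r m) + norm (t *\<^sub>R M (r (m + k)))"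
        using norm_triangle_ineq4[of "r (m + k) - r m" "t *\<^sub>R M (r (m + k))"]
        by (simp add: r_Suc algebra_simps)
      also have "\<dots> \<le> t * (\<Sum>j\<in>{m..<m+Suc k}. norm (M (r j)))"
        using Suc.IH t by (simp add: algebra_simps)
      finally show ?case .
    qed simp
    have "Cauchy r"
    proof (rule CauchyI')
      fix e :: real assume "e > 0"
      then obtain N where N: "\<And>m n. m \<ge> N \<Longrightarrow> norm (\<Sum>j\<in>{m..<n}. norm (M (r j))) < e / t"
        using summ t unfolding summable_Cauchy by (meson divide_pos_pos)
      have "dist (r m) (r n) < e" if "m \<ge> N" "n > m" for m n
      proof -
        have "dist (r m) (r n) = norm (r (m + (n - m)) - r m)"
          using that by (simp add: dist_norm norm_minus_commute)
        also have "\<dots> \<le> t * (\<Sum>j\<in>{m..<n}. norm (M (r j)))"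
          using step[of m "n - m"] that by simp
        also have "\<dots> < t * (e / t)"
          using N[OF that(1), of n] t by (intro mult_strict_left_mono) auto
        finally show ?thesis using t by simp
      qed
      then show "\<exists>N. \<forall>m\<ge>N. \<forall>n>m. dist (r m) (r n) < e" by blast
    qed
    then obtain l where l: "r \<longlonglongrightarrow> l"
      using Cauchy_convergent convergent_def by blast
    have "(\<lambda>n. nM (r n)) \<longlonglongrightarrow> 0"
    proof (rule tendsto_sandwich[OF _ _ tendsto_const])
      show "(\<lambda>n. q ^ n * nM x) \<longlonglongrightarrow> 0"
        using tendsto_mult_right[OF LIMSEQ_realpow_zero[OF q(1,2)], of "nM x"] by simp
    qed (use rq in auto)
    then have "l = 0"
      using tendsto_nM_of_tendsto[OF l] LIMSEQ_unique nM_eq_0_iff by metis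
    then have "(\<lambda>n. norm (r n - r 0)) \<longlonglongrightarrow> norm (0 - r 0)"
      using l by (intro tendsto_intros) auto
    then have "norm (0 - r 0) \<le> t * (K * nM x * (1 / (1 - q)))"
    proof (rule LIMSEQ_le_const2, intro exI allI impI)
      fix n
      have "norm (r n - r 0) \<le> t * (\<Sum>j\<in>{..<n}. norm (M (r j)))"
        using step[of 0 n] by (simp add: lessThan_atLeast0)
      also have "(\<Sum>j\<in>{..<n}. norm (M (r j))) \<le> (\<Sum>j\<in>{..<n}. K * nM x * q ^ j)"
        by (intro sum_mono Mr)
      also have "\<dots> \<le> (\<Sum>j. K * nM x * q ^ j)"
        using K(1) q by (intro sum_le_suminf sums_summable[OF geo]) auto
      also have "\<dots> = K * nM x * (1 / (1 - q))"
        using geo by (rule sums_unique[symmetric])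
      finally show "norm (r n - r 0) \<le> t * (K * nM x * (1 / (1 - q)))"
        using t by simp
    qed
    then show ?thesis by (simp add: r_def mult_ac)
  qed
  show ?thesis
    using t K q bound by (intro exI[of _ "t * K / (1 - q)"]) auto
qed

end

section \<open>Blocks and selections\<close>

locale direct_sum =
  fixes H :: "'m::finite \<Rightarrow> 'a::{real_inner, complete_space} set"
  assumes direct_sum: "hilbert_direct_sum H"
begin

lemma subspace_H: "subspace (H i)"
  and H_orthogonal: "i \<noteq> j \<Longrightarrow> x \<in> H i \<Longrightarrow> y \<in> H j \<Longrightarrow> inner x y = 0"
  and H_decomposition: "\<exists>f. (\<forall>i. f i \<in> H i) \<and> x = (\<Sum>i\<in>UNIV. f i)"
  using direct_sum unfolding hilbert_direct_sum_def by blast+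

lemma inner_sum_H:
  assumes "\<And>i. f i \<in> H i" and "y \<in> H j"
  shows "inner (\<Sum>i\<in>UNIV. f i) y = inner (f j) y"
proof -
  have "inner (\<Sum>i\<in>UNIV. f i) y = (\<Sum>i\<in>UNIV. if i = j then inner (f j) y else 0)"
    unfolding inner_sum_left using assms by (intro sum.cong) (auto simp: H_orthogonal)
  then show ?thesis by simp
qed

lemma block_of_sum:
  assumes f: "\<And>i. f i \<in> H i"
  shows "block H i (\<Sum>j\<in>UNIV. f j) = f i"
proof -
  have "g = f" if g: "\<And>i. g i \<in> H i" and eq: "(\<Sum>j\<in>UNIV. f j) = (\<Sum>j\<in>UNIV. g j)" for g
  proof
    fix j
    have d: "f i - g i \<in> H i" for i
      using f g by (simp add: subspace_H subspace_diff)
    have "inner (\<Sum>i\<in>UNIV. f i - g i) (f j - g j) = inner (f j - g j) (f j - g j)"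
      by (intro inner_sum_H d)
    then show "g j = f j"
      by (simp add: sum_subtractf eq)
  qed
  then have "(THE g. (\<forall>j. g j \<in> H j) \<and> (\<Sum>j\<in>UNIV. f j) = (\<Sum>j\<in>UNIV. g j)) = f"
    using f by (intro the_equality) auto
  then show ?thesis
    unfolding block_def by simp
qed

lemma block_in: "block H i x \<in> H i" and sum_block: "(\<Sum>i\<in>UNIV. block H i x) = x"
proof -
  obtain f where f: "\<And>i. f i \<in> H i" "x = (\<Sum>i\<in>UNIV. f i)"
    using H_decomposition by blast
  then have "block H i x = f i" for i
    using block_of_sum[of f] by simp
  then show "block H i x \<in> H i" "(\<Sum>i\<in>UNIV. block H i x) = x"
    using f by simp_all
qed

lemma norm_block_le: "norm (block H i x) \<le> norm x"
proof (cases "block H i x = 0")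
  case False
  have "norm (block H i x) * norm (block H i x) = inner (\<Sum>j\<in>UNIV. block H j x) (block H i x)"
    by (subst inner_sum_H) (auto simp: block_in power2_norm_eq_inner simp flip: power2_eq_square)
  also have "\<dots> \<le> norm x * norm (block H i x)"
    unfolding sum_block by (rule norm_cauchy_schwarz)
  finally show ?thesis using False by simp
qed simp

lemma bounded_linear_block: "bounded_linear (block H i)"
proof (rule bounded_linear_intro[where K = 1])
  fix x y :: 'a and r :: real
  have "block H i (\<Sum>j\<in>UNIV. block H j x + block H j y) = block H i x + block H i y"
    by (intro block_of_sum) (simp add: subspace_H subspace_add block_in)
  then show "block H i (x + y) = block H i x + block H i y"
    by (simp add: sum.distrib sum_block)
  have "block H i (\<Sum>j\<in>UNIV. r *\<^sub>R block H j x) = r *\<^sub>R block H i x"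
    by (intro block_of_sum) (simp add: subspace_H subspace_scale block_in)
  then show "block H i (r *\<^sub>R x) = r *\<^sub>R block H i x"
    by (simp add: sum_block flip: scaleR_sum_right)
qed (simp add: norm_block_le)

lemma T_select_eq:
  assumes "\<theta> \<noteq> 0"
  shows "T_select H \<theta> T s x = x - select H s (x - T x)"
proof -
  have "\<theta> *\<^sub>R (s $ i *\<^sub>R block H i ((1 / \<theta>) *\<^sub>R (x - T x))) = s $ i *\<^sub>R block H i (x - T x)" for i
    using assms by (simp add: linear_scale[OF bounded_linear.linear[OF bounded_linear_block]])
  then show ?thesis
    unfolding T_select_def S_select_def S_block_def S_op_def select_def
    by (simp add: scaleR_sum_right)
qed

lemma continuous_on_select [continuous_intros]:
  assumes "continuous_on S f" "continuous_on S g"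
  shows "continuous_on S (\<lambda>x. select H (f x) (g x))"
  unfolding select_def
  by (intro continuous_intros assms bounded_linear.continuous_on[OF bounded_linear_block])

lemma norm_select_le:
  assumes "\<And>i. \<bar>s $ i\<bar> \<le> R"
  shows "norm (select H s u) \<le> CARD('m) * (R * norm u)"
proof -
  have "norm (select H s u) \<le> (\<Sum>i\<in>(UNIV::'m set). R * norm u)"
    unfolding select_def
    by (intro sum_norm_le) (auto intro!: mult_mono assms norm_block_le order_trans[OF abs_ge_zero assms])
  then show ?thesis by simp
qed

end

section \<open>Averaged operators and their infimal displacement\<close>

locale averaged_operator = metric_operator M
  for M :: "'a::{real_inner, complete_space} \<Rightarrow> 'a" +
  fixes \<theta> :: real and T :: "'a \<Rightarrow> 'a"
  assumes \<theta>_pos: "0 < \<theta>" and \<theta>_le_1: "\<theta> \<le> 1" and averaged: "averaged M \<theta> T"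
begin

definition disp :: "'a \<Rightarrow> 'a" where
  "disp x = x - T x"

text \<open>Up to the factor \<open>\<theta>\<^sup>2\<close>, this is the expansion of \<open>nM (C x - C y) \<le> nM (x - y)\<close> for the
  non-expansive part \<open>C\<close> of \<open>T\<close>, since \<open>disp x = \<theta> (x - C x)\<close>.\<close>

lemma cocoercive: "(nM (disp x - disp y))\<^sup>2 \<le> 2 * \<theta> * ip (x - y) (disp x - disp y)"
proof -
  obtain C where C: "\<And>x y. nM (C x - C y) \<le> nM (x - y)"
    and T: "\<And>x. T x = (1 - \<theta>) *\<^sub>R x + \<theta> *\<^sub>R C x"
    using averaged unfolding averaged_def nonexpansive_def by blast
  have d: "disp x - disp y = \<theta> *\<^sub>R ((x - y) - (C x - C y))"
    by (simp add: disp_def T algebra_simps)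
  have sq: "(nM (C x - C y))\<^sup>2 \<le> (nM (x - y))\<^sup>2"
    by (intro power_mono C nM_nonneg)
  have "(nM ((x - y) - (C x - C y)))\<^sup>2 \<le> 2 * ip (x - y) ((x - y) - (C x - C y))"
    unfolding nM_sq_diff[of "x - y"] ip_simps(4)[of "x - y" "x - y"] nM_sq[symmetric]
    using sq by (simp add: algebra_simps)
  then have "\<theta>\<^sup>2 * (nM ((x - y) - (C x - C y)))\<^sup>2 \<le> \<theta>\<^sup>2 * (2 * ip (x - y) ((x - y) - (C x - C y)))"
    by (intro mult_left_mono) auto
  then show ?thesis
    by (simp add: d nM_scaleR power_mult_distrib ip_simps(6) power2_eq_square mult_ac)
qed

lemma disp_monotone: "0 \<le> ip (x - y) (disp x - disp y)"
  using order_trans[OF zero_le_power2 cocoercive[of x y]] \<theta>_pos by (simp add: zero_le_mult_iff)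

lemma T_nonexpansive: "nM (T x - T y) \<le> nM (x - y)"
proof (rule power2_le_imp_le)
  have "T x - T y = (x - y) - (disp x - disp y)"
    by (simp add: disp_def)
  then have "(nM (T x - T y))\<^sup>2
      = (nM (x - y))\<^sup>2 - 2 * ip (x - y) (disp x - disp y) + (nM (disp x - disp y))\<^sup>2"
    by (simp add: nM_sq_diff)
  also have "(nM (disp x - disp y))\<^sup>2 \<le> 2 * 1 * ip (x - y) (disp x - disp y)"
    by (rule order_trans[OF cocoercive]) (intro mult_right_mono mult_left_mono disp_monotone; simp add: \<theta>_le_1)
  finally show "(nM (T x - T y))\<^sup>2 \<le> (nM (x - y))\<^sup>2" by simp
qed simp

lemma disp_lipschitz: "\<exists>L>0. \<forall>x y. norm (disp x - disp y) \<le> L * norm (x - y)"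
proof -
  obtain C where C: "C > 0" "\<And>x. norm x \<le> C * nM x"
    using norm_le_nM by blast
  obtain K where K: "K > 0" "\<And>x. nM x \<le> K * norm x"
    using nM_le_norm by blast
  have "norm (disp x - disp y) \<le> (1 + C * K) * norm (x - y)" for x y
  proof -
    have "norm (disp x - disp y) \<le> norm (x - y) + norm (T x - T y)"
      using norm_triangle_ineq4[of "x - y" "T x - T y"] by (simp add: disp_def algebra_simps)
    also have "norm (T x - T y) \<le> C * nM (T x - T y)"
      by (rule C)
    also have "\<dots> \<le> C * (K * norm (x - y))"
      using C K(2)[of "x - y"] T_nonexpansive[of x y] by (intro mult_left_mono) linarith+
    finally show ?thesis by (simp add: algebra_simps)
  qed
  then show ?thesis
    using C K by (intro exI[of _ "1 + C * K"]) (auto intro: add_pos_pos)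
qed

lemma continuous_on_disp [continuous_intros]:
  assumes "continuous_on S f"
  shows "continuous_on S (\<lambda>x. disp (f x))"
proof -
  obtain L where L: "L > 0" "\<And>x y. norm (disp x - disp y) \<le> L * norm (x - y)"
    using disp_lipschitz by blast
  have "L-lipschitz_on UNIV disp"
    using L by (intro lipschitz_onI) (auto simp: dist_norm)
  then have "continuous_on UNIV disp"
    by (rule lipschitz_on_continuous_on)
  then show ?thesis
    by (rule continuous_on_compose2[OF _ assms]) simp
qed

text \<open>The point is an approximate solution \<open>z\<close> of \<open>(1 + \<mu>) z = T z\<close>, found by iterating the contraction
  \<open>z \<mapsto> T z / (1 + \<mu>)\<close>. At such a point \<open>disp z\<close> is almost \<open>- \<mu> z\<close>, and monotonicity of
  \<open>disp\<close> between \<open>z\<close> and \<open>x\<close> yields the bound.\<close>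

lemma approximate_resolvent:
  assumes "\<mu> > 0"
  shows "\<exists>z. \<forall>x. ip (disp z) (disp z - disp x) \<le> \<mu> * (1 + nM x) * nM (disp z - disp x)"
proof -
  define q where "q = 1 / (1 + \<mu>)"
  have q: "0 < q" "q < 1" "(1 + \<mu>) * q = 1"
    using assms by (auto simp: q_def)
  define Z where "Z n = ((\<lambda>z. q *\<^sub>R T z) ^^ n) 0" for n
  have Z_Suc: "Z (Suc n) = q *\<^sub>R T (Z n)" for n
    by (simp add: Z_def)
  have Z: "nM (Z n - Z (Suc n)) \<le> nM (Z 0 - Z 1) * q ^ n" for n
  proof (induction n)
    case (Suc n)
    have "nM (Z (Suc n) - Z (Suc (Suc n))) = q * nM (T (Z n) - T (Z (Suc n)))"
      using q nM_scaleR[of q "T (Z n) - T (Z (Suc n))"] unfolding Z_Suc by (simp add: scaleR_diff_right)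
    also have "\<dots> \<le> q * (nM (Z 0 - Z 1) * q ^ n)"
      using q by (intro mult_left_mono order_trans[OF T_nonexpansive Suc.IH]) auto
    finally show ?case by (simp add: mult_ac)
  qed simp
  have "(\<lambda>n. nM (Z 0 - Z 1) * q ^ n) \<longlonglongrightarrow> nM (Z 0 - Z 1) * 0"
    using q by (intro tendsto_mult_left LIMSEQ_realpow_zero) auto
  then have "\<forall>\<^sub>F n in sequentially. nM (Z 0 - Z 1) * q ^ n < \<mu> * q"
    using assms q by (intro order_tendstoD(2)) auto
  then obtain n where n: "nM (Z 0 - Z 1) * q ^ n < \<mu> * q"
    by (auto simp: eventually_sequentially)
  define z where "z = Z n"
  define r where "r = (1 + \<mu>) *\<^sub>R (z - q *\<^sub>R T z)"
  have "nM (z - q *\<^sub>R T z) \<le> \<mu> * q"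
    using Z[of n] n unfolding z_def Z_Suc by linarith
  then have "(1 + \<mu>) * nM (z - q *\<^sub>R T z) \<le> (1 + \<mu>) * (\<mu> * q)"
    using assms by (intro mult_left_mono) auto
  then have r: "nM r \<le> \<mu>"
    using assms q by (simp add: r_def nM_scaleR mult.left_commute)
  have r_eq: "r = disp z + \<mu> *\<^sub>R z"
    using q by (simp add: r_def disp_def scaleR_diff_right scaleR_add_left)
  show ?thesis
  proof (intro exI allI)
    fix x
    define d where "d = disp z - disp x"
    have "0 \<le> \<mu> * ip (z - x) d"
      using assms disp_monotone[of z x] by (simp add: d_def)
    also have "\<dots> = ip (r - disp z - \<mu> *\<^sub>R x) d"
      by (simp add: r_eq ip_simps algebra_simps)
    finally have "ip (disp z) d \<le> ip (r - \<mu> *\<^sub>R x) d"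
      by (simp add: ip_simps)
    also have "\<dots> \<le> nM (r - \<mu> *\<^sub>R x) * nM d"
      by (rule ip_le_nM)
    also have "\<dots> \<le> (\<mu> * (1 + nM x)) * nM d"
      using nM_triangle[of r "- \<mu> *\<^sub>R x"] r assms nM_scaleR[of "- \<mu>" x]
      by (intro mult_right_mono) (auto simp: algebra_simps)
    finally show "ip (disp z) (disp z - disp x) \<le> \<mu> * (1 + nM x) * nM (disp z - disp x)"
      by (simp add: d_def)
  qed
qed

text \<open>A single sequence serves every \<open>x\<close>: \<open>disp (Z n)\<close> stays bounded as \<open>\<mu> = 1 / (n + 1)\<close>
  tends to \<open>0\<close>, so the right-hand side of the previous bound is of order \<open>\<mu>\<close>.\<close>

lemma approximate_resolvents:
  "\<exists>Z. \<forall>x. \<exists>B. \<forall>n. ip (disp (Z n)) (disp (Z n) - disp x) \<le> B / real (Suc n)"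
proof -
  have "\<forall>n. \<exists>z. \<forall>x. ip (disp z) (disp z - disp x) \<le> 1 / real (Suc n) * (1 + nM x) * nM (disp z - disp x)"
    by (intro allI approximate_resolvent) simp
  then obtain Z where Z: "\<And>n x. ip (disp (Z n)) (disp (Z n) - disp x)
      \<le> 1 / real (Suc n) * (1 + nM x) * nM (disp (Z n) - disp x)"
    by (auto simp only: choice_iff)
  have "ip (disp (Z n)) (disp (Z n) - disp x) \<le> ((1 + nM x) * (1 + nM x + nM (disp x))) / real (Suc n)" for n x
  proof -
    define d where "d = disp (Z n) - disp x"
    have "nM d * nM d = ip (disp (Z n)) d - ip (disp x) d"
      by (simp add: d_def ip_simps nM_sq flip: power2_eq_square)
    also have "\<dots> \<le> 1 / real (Suc n) * (1 + nM x) * nM d + nM (disp x) * nM d"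
      using Z[of n x] abs_ip_le_nM[of "disp x" d] by (simp add: d_def)
    also have "\<dots> = (1 / real (Suc n) * (1 + nM x) + nM (disp x)) * nM d"
      by (simp add: algebra_simps)
    also have "\<dots> \<le> (1 * (1 + nM x) + nM (disp x)) * nM d"
      by (intro mult_right_mono add_mono) auto
    finally have "nM d \<le> 1 + nM x + nM (disp x)"
      by (cases "nM d = 0") (auto simp: add_nonneg_nonneg order_less_le)
    then have "1 / real (Suc n) * (1 + nM x) * nM d
        \<le> 1 / real (Suc n) * (1 + nM x) * (1 + nM x + nM (disp x))"
      by (intro mult_left_mono) auto
    then show ?thesis
      using Z[of n x] by (simp add: d_def)
  qed
  then show ?thesis by blast
qed

end

locale displacement_operator = averaged_operator M \<theta> T
  for M :: "'a::{real_inner, complete_space} \<Rightarrow> 'a" and \<theta> T +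
  fixes v :: 'a
  assumes infimal: "infimal_displacement M T v"
begin

lemma nM_v_le: "nM v \<le> nM (disp x)"
  using infimal closure_subset[of "range (\<lambda>x. x - T x)"]
  unfolding infimal_displacement_def disp_def by blast

lemma disp_near_v:
  assumes "\<epsilon> > 0"
  shows "\<exists>x. nM (disp x - v) < \<epsilon>"
proof -
  obtain K where K: "K > 0" "\<And>x. nM x \<le> K * norm x"
    using nM_le_norm by blast
  obtain x where "dist (disp x) v < \<epsilon> / K"
    using infimal assms K(1) unfolding infimal_displacement_def closure_approachable disp_def
    by (metis (no_types, lifting) divide_pos_pos rangeE)
  then have "K * norm (disp x - v) < \<epsilon>"
    using K(1) by (simp add: dist_norm field_simps)
  then show ?thesis
    using K(2)[of "disp x - v"] by (intro exI[of _ x]) linarith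
qed

text \<open>Let \<open>disp y\<close> be near \<open>v\<close>, and take \<open>z\<close> from the sequence of approximate resolvents. The
  square of \<open>nM (disp z - disp y)\<close> is \<open>2 ip (disp z) (disp z - disp y)\<close>, which becomes small,
  plus the excess of \<open>(nM (disp y))\<^sup>2\<close> over \<open>(nM (disp z))\<^sup>2 \<ge> (nM v)\<^sup>2\<close>. So \<open>disp z\<close> is near \<open>v\<close>
  as well.\<close>

lemma disp_near_v_almost_minimal:
  assumes "\<epsilon> > 0"
  shows "\<exists>z. nM (disp z - v) < \<epsilon> \<and> ip (disp z) (disp z - disp x) < \<epsilon>"
proof -
  obtain Z where Z: "\<And>x. \<exists>B. \<forall>n. ip (disp (Z n)) (disp (Z n) - disp x) \<le> B / real (Suc n)"
    using approximate_resolvents by blast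
  define D where "D = 2 * nM v + 1"
  have D: "D > 0"
    using nM_nonneg[of v] unfolding D_def by linarith
  \<comment> \<open>small enough that \<open>(nM v + \<eta>)\<^sup>2\<close> exceeds \<open>(nM v)\<^sup>2\<close> by at most \<open>\<epsilon>\<^sup>2 / 8\<close>\<close>
  define \<eta> where "\<eta> = min 1 (min (\<epsilon> / 2) (\<epsilon>\<^sup>2 / (8 * D)))"
  have \<eta>: "0 < \<eta>" "\<eta> \<le> 1" "\<eta> \<le> \<epsilon> / 2" "\<eta> \<le> \<epsilon>\<^sup>2 / (8 * D)"
  proof -
    show "0 < \<eta>"
      using assms D by (simp add: \<eta>_def)
    show "\<eta> \<le> 1" "\<eta> \<le> \<epsilon> / 2" "\<eta> \<le> \<epsilon>\<^sup>2 / (8 * D)"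
      unfolding \<eta>_def by (meson min.cobounded1 min.cobounded2 order_trans)+
  qed
  have \<eta>D: "\<eta> * D \<le> \<epsilon>\<^sup>2 / 8"
    using \<eta>(4) D by (simp add: field_simps)
  obtain y where y: "nM (disp y - v) < \<eta>"
    using disp_near_v[OF \<eta>(1)] by blast
  have "nM (disp y) \<le> nM v + \<eta>"
    using y nM_triangle[of "disp y - v" v] by simp
  then have "(nM (disp y))\<^sup>2 \<le> (nM v + \<eta>)\<^sup>2"
    by (intro power_mono) auto
  also have "\<dots> = (nM v)\<^sup>2 + \<eta> * (2 * nM v + \<eta>)"
    by (simp add: power2_eq_square algebra_simps)
  also have "\<dots> \<le> (nM v)\<^sup>2 + \<eta> * D"
    unfolding D_def using \<eta> by (intro add_left_mono mult_left_mono) auto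
  finally have y2: "(nM (disp y))\<^sup>2 \<le> (nM v)\<^sup>2 + \<epsilon>\<^sup>2 / 8"
    using \<eta>D by linarith
  obtain Bx By where B: "\<And>n. ip (disp (Z n)) (disp (Z n) - disp x) \<le> Bx / real (Suc n)"
    "\<And>n. ip (disp (Z n)) (disp (Z n) - disp y) \<le> By / real (Suc n)"
    using Z by meson
  have "(\<lambda>n. Bx / real (Suc n)) \<longlonglongrightarrow> 0" "(\<lambda>n. By / real (Suc n)) \<longlonglongrightarrow> 0"
    by (rule filterlim_compose[OF lim_const_over_n filterlim_Suc])+
  then have "\<forall>\<^sub>F n in sequentially. Bx / real (Suc n) < \<epsilon> \<and> By / real (Suc n) < \<epsilon>\<^sup>2 / 16"
    using assms by (intro eventually_conj order_tendstoD(2)) auto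
  then obtain n where n: "Bx / real (Suc n) < \<epsilon>" "By / real (Suc n) < \<epsilon>\<^sup>2 / 16"
    by (auto simp: eventually_sequentially)
  define z where "z = Z n"
  have z: "ip (disp z) (disp z - disp x) < \<epsilon>" "ip (disp z) (disp z - disp y) < \<epsilon>\<^sup>2 / 16"
    using B(1)[of n] B(2)[of n] n unfolding z_def by linarith+
  have "(nM (disp z - disp y))\<^sup>2
      = 2 * ip (disp z) (disp z - disp y) + (nM (disp y))\<^sup>2 - (nM (disp z))\<^sup>2"
    by (simp add: nM_sq_diff) (simp add: ip_simps nM_sq)
  also have "\<dots> < (\<epsilon> / 2)\<^sup>2"
  proof -
    have "(nM v)\<^sup>2 \<le> (nM (disp z))\<^sup>2"
      by (intro power_mono nM_v_le) simp
    moreover have "(\<epsilon> / 2)\<^sup>2 = \<epsilon>\<^sup>2 / 4"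
      by (simp add: power_divide)
    ultimately show ?thesis
      using z(2) y2 by linarith
  qed
  finally have "nM (disp z - disp y) < \<epsilon> / 2"
    using assms by (intro power2_less_imp_less[of "nM (disp z - disp y)"]) auto
  then have "nM (disp z - v) < \<epsilon>"
    using nM_triangle_diff[of "disp z" v "disp y"] y \<eta> by linarith
  then show ?thesis
    using z by blast
qed

text \<open>On a convex set, this inequality characterises the element of minimal norm. The range of
  \<open>disp\<close> need not be convex; the inequality is instead the limit of its approximate versions at
  points \<open>z\<close> with \<open>disp z\<close> tending to \<open>v\<close>.\<close>

lemma variational: "0 \<le> ip v (disp x - v)"
proof -
  have "\<forall>n. \<exists>z. nM (disp z - v) < 1 / real (Suc n) \<and> ip (disp z) (disp z - disp x) < 1 / real (Suc n)"
    by (intro allI disp_near_v_almost_minimal) simp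
  then obtain z where z: "\<And>n. nM (disp (z n) - v) < 1 / real (Suc n)"
    "\<And>n. ip (disp (z n)) (disp (z n) - disp x) < 1 / real (Suc n)"
    by (auto simp only: choice_iff)
  have inv: "(\<lambda>n. 1 / real (Suc n)) \<longlonglongrightarrow> 0"
    by (rule filterlim_compose[OF lim_const_over_n filterlim_Suc])
  have conv: "(\<lambda>n. nM (disp (z n) - v)) \<longlonglongrightarrow> 0"
    by (rule tendsto_sandwich[OF _ _ tendsto_const inv])
       (use z(1) in \<open>auto simp del: of_nat_Suc intro!: always_eventually less_imp_le\<close>)
  obtain C where C: "C > 0" "\<And>x. norm x \<le> C * nM x"
    using norm_le_nM by blast
  have "(\<lambda>n. C * nM (disp (z n) - v)) \<longlonglongrightarrow> 0"
    using tendsto_mult_left[OF conv, of C] by simp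
  then have "(\<lambda>n. disp (z n) - v) \<longlonglongrightarrow> 0"
    by (rule Lim_null_comparison[rotated]) (intro always_eventually allI C(2))
  then have "(\<lambda>n. disp (z n)) \<longlonglongrightarrow> v"
    by (rule LIM_zero_cancel)
  then have "(\<lambda>n. ip (disp (z n)) (disp (z n) - disp x)) \<longlonglongrightarrow> ip v (v - disp x)"
    by (intro bounded_bilinear.tendsto[OF bounded_bilinear_ip] tendsto_intros)
  then have "ip v (v - disp x) \<le> 0"
    using inv z(2) by (intro LIMSEQ_le) (auto intro: less_imp_le)
  then show ?thesis
    by (simp add: ip_simps)
qed

text \<open>Hence a displacement is close to \<open>v\<close> once its norm is close to the minimal one.\<close>

lemma nM_disp_diff_v: "(nM (disp x - v))\<^sup>2 \<le> (nM (disp x))\<^sup>2 - (nM v)\<^sup>2"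
  using variational[of x] unfolding nM_sq_diff
  by (simp add: ip_simps ip_commute[of v "disp x"] nM_sq)

end

section \<open>The deterministic reference sequence\<close>

locale relaxed_iteration = displacement_operator M \<theta> T v
  for M :: "'a::{real_inner, complete_space} \<Rightarrow> 'a" and \<theta> T v +
  fixes \<alpha> :: real
  assumes \<alpha>_pos: "0 < \<alpha>" and \<alpha>\<theta>_le_1: "\<alpha> * \<theta> \<le> 1"
begin

text \<open>The mean of one random step, as the selection vectors have mean \<open>\<alpha> 1\<close>.\<close>

definition G :: "'a \<Rightarrow> 'a" where
  "G z = z - \<alpha> *\<^sub>R disp z"

lemma G_contracts:
  "(nM (G x - G y))\<^sup>2 \<le> (nM (x - y))\<^sup>2 - \<alpha> * (1 / \<theta> - \<alpha>) * (nM (disp x - disp y))\<^sup>2"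
proof -
  have "(nM (disp x - disp y))\<^sup>2 / \<theta> \<le> 2 * ip (x - y) (disp x - disp y)"
    using cocoercive[of x y] \<theta>_pos by (simp add: field_simps)
  then have *: "\<alpha> * ((nM (disp x - disp y))\<^sup>2 / \<theta>) \<le> \<alpha> * (2 * ip (x - y) (disp x - disp y))"
    using \<alpha>_pos by (intro mult_left_mono) auto
  have "G x - G y = (x - y) - \<alpha> *\<^sub>R (disp x - disp y)"
    by (simp add: G_def algebra_simps)
  then have "(nM (G x - G y))\<^sup>2 = (nM (x - y))\<^sup>2 - \<alpha> * (2 * ip (x - y) (disp x - disp y))
      + \<alpha>\<^sup>2 * (nM (disp x - disp y))\<^sup>2"
    by (simp add: nM_sq_diff nM_scaleR ip_simps(6) power_mult_distrib)
  also have "\<dots> \<le> (nM (x - y))\<^sup>2 - \<alpha> * (1 / \<theta> - \<alpha>) * (nM (disp x - disp y))\<^sup>2"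
    using * by (simp add: power2_eq_square algebra_simps)
  finally show ?thesis .
qed

lemma nM_disp_G_le: "nM (disp (G z)) \<le> nM (disp z)"
proof -
  have "\<alpha> * (1 / \<theta> - \<alpha>) * (nM (disp z - disp (G z)))\<^sup>2 \<ge> 0"
    using \<alpha>_pos \<theta>_pos \<alpha>\<theta>_le_1 by (intro mult_nonneg_nonneg) (auto simp: field_simps)
  then have "(nM (G z - G (G z)))\<^sup>2 \<le> (nM (z - G z))\<^sup>2"
    using G_contracts[of z "G z"] by linarith
  then have "nM (G z - G (G z)) \<le> nM (z - G z)"
    by (rule power2_le_imp_le) simp
  moreover have "z - G z = \<alpha> *\<^sub>R disp z" for z
    by (simp add: G_def)
  ultimately show ?thesis
    using \<alpha>_pos by (simp add: nM_scaleR)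
qed

lemma nM_disp_G_pow_le: "nM (disp ((G ^^ k) z)) \<le> nM (disp z)"
  by (induction k) (auto intro: order_trans[OF nM_disp_G_le])

lemma disp_G_pow_attained:
  assumes "disp z = v"
  shows "disp ((G ^^ k) z) = v"
proof -
  have "(nM (disp ((G ^^ k) z)))\<^sup>2 \<le> (nM v)\<^sup>2"
    using nM_disp_G_pow_le[of k z] assms by (intro power_mono) auto
  then have "(nM (disp ((G ^^ k) z) - v))\<^sup>2 \<le> 0"
    using nM_disp_diff_v[of "(G ^^ k) z"] by linarith
  then show ?thesis by simp
qed

lemma G_pow_attained:
  assumes "disp z = v"
  shows "(G ^^ k) z = z - (real k * \<alpha>) *\<^sub>R v"
proof (induction k)
  case (Suc k)
  have "(G ^^ Suc k) z = (G ^^ k) z - \<alpha> *\<^sub>R disp ((G ^^ k) z)"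
    by (simp add: G_def)
  also have "\<dots> = z - (real k * \<alpha>) *\<^sub>R v - \<alpha> *\<^sub>R v"
    unfolding disp_G_pow_attained[OF assms] by (simp only: Suc.IH)
  finally show ?case
    by (simp add: algebra_simps)
qed simp

text \<open>Two trajectories of \<open>G\<close> have asymptotically equal displacements, as the squared differences
  of these are summable. One trajectory may be started where \<open>nM (disp x)\<close> is nearly minimal, and
  it stays so.\<close>

lemma disp_G_pow_tendsto:
  assumes "\<alpha> * \<theta> < 1"
  shows "(\<lambda>k. nM (disp ((G ^^ k) z) - v)) \<longlonglongrightarrow> 0"
proof -
  define \<kappa> where "\<kappa> = \<alpha> * (1 / \<theta> - \<alpha>)"
  have \<kappa>: "\<kappa> > 0"
    using assms \<alpha>_pos \<theta>_pos by (simp add: \<kappa>_def field_simps)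
  have diff: "(\<lambda>k. nM (disp ((G ^^ k) z) - disp ((G ^^ k) x))) \<longlonglongrightarrow> 0" for x
  proof -
    let ?u = "\<lambda>k. (nM (disp ((G ^^ k) z) - disp ((G ^^ k) x)))\<^sup>2"
    have "\<kappa> * (\<Sum>k<n. ?u k) \<le> (nM (z - x))\<^sup>2 - (nM ((G ^^ n) z - (G ^^ n) x))\<^sup>2" for n
    proof (induction n)
      case (Suc n)
      then show ?case
        using G_contracts[of "(G ^^ n) z" "(G ^^ n) x"] by (simp add: \<kappa>_def distrib_left)
    qed simp
    then have "\<kappa> * (\<Sum>k<n. ?u k) \<le> (nM (z - x))\<^sup>2" for n
      by (rule order_trans) simp
    then have "(\<Sum>k<n. ?u k) \<le> (nM (z - x))\<^sup>2 / \<kappa>" for n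
      using \<kappa> by (simp add: field_simps)
    then have "summable ?u"
      by (intro summableI_nonneg_bounded) auto
    then have "?u \<longlonglongrightarrow> 0"
      by (rule summable_LIMSEQ_zero)
    then show ?thesis
      using tendsto_real_sqrt by fastforce
  qed
  have lim: "(\<lambda>k. nM (disp ((G ^^ k) z))) \<longlonglongrightarrow> nM v"
  proof (rule order_tendstoI)
    fix a assume "a < nM v"
    then show "\<forall>\<^sub>F k in sequentially. a < nM (disp ((G ^^ k) z))"
      by (intro always_eventually allI order_less_le_trans[OF _ nM_v_le])
  next
    fix a assume a: "nM v < a"
    then obtain x where x: "nM (disp x - v) < (a - nM v) / 2"
      using disp_near_v[of "(a - nM v) / 2"] by auto
    have "\<forall>\<^sub>F k in sequentially. nM (disp ((G ^^ k) z) - disp ((G ^^ k) x)) < (a - nM v) / 2"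
      using diff a by (intro order_tendstoD(2)) auto
    then show "\<forall>\<^sub>F k in sequentially. nM (disp ((G ^^ k) z)) < a"
    proof eventually_elim
      case (elim k)
      have "nM (disp ((G ^^ k) z)) \<le> nM (disp ((G ^^ k) z) - disp ((G ^^ k) x)) + nM (disp ((G ^^ k) x))"
        using nM_triangle[of "disp ((G ^^ k) z) - disp ((G ^^ k) x)" "disp ((G ^^ k) x)"] by simp
      moreover have "nM (disp x) \<le> nM (disp x - v) + nM v"
        using nM_triangle[of "disp x - v" v] by simp
      ultimately show ?case
        using elim x nM_disp_G_pow_le[of k x] by (simp add: field_simps)
    qed
  qed
  have "(\<lambda>k. (nM (disp ((G ^^ k) z) - v))\<^sup>2) \<longlonglongrightarrow> 0"
  proof (rule tendsto_sandwich[OF _ _ tendsto_const])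
    show "(\<lambda>k. (nM (disp ((G ^^ k) z)))\<^sup>2 - (nM v)\<^sup>2) \<longlonglongrightarrow> 0"
      using tendsto_diff[OF tendsto_power[OF lim, of 2] tendsto_const[of "(nM v)\<^sup>2"]] by simp
  qed (use nM_disp_diff_v in auto)
  then show ?thesis
    using tendsto_real_sqrt by fastforce
qed

end

section \<open>Expectation in a non-separable space\<close>

text \<open>In a non-separable space the difference of two measurable functions can fail to be
  measurable. As \<open>s\<close> has finite range, only differences with constants occur here.\<close>

lemma borel_measurable_norm_diff_simple:
  fixes X :: "'w \<Rightarrow> 'a::real_normed_vector"
  assumes X: "X \<in> borel_measurable P" and s: "simple_function P s"
  shows "(\<lambda>\<omega>. norm (X \<omega> - s \<omega>)) \<in> borel_measurable P"
proof (rule measurable_compose_countable'[where I = "s ` space P" and g = s and f = "\<lambda>c \<omega>. norm (X \<omega> - c)"])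
  show "s \<in> measurable P (count_space (s ` space P))"
    using s unfolding simple_function_def
    by (subst measurable_count_space_eq2) auto
  show "countable (s ` space P)"
    using s by (auto simp: simple_function_def countable_finite)
  show "(\<lambda>\<omega>. norm (X \<omega> - c)) \<in> borel_measurable P" for c
    by (rule measurable_compose[OF X]) (intro borel_measurable_continuous_onI continuous_intros)
qed

lemma has_expectation_inner:
  fixes X :: "'w \<Rightarrow> 'a::real_inner"
  assumes "has_expectation P X e"
  shows "has_bochner_integral P (\<lambda>\<omega>. inner (X \<omega>) h) (inner e h)"
proof -
  obtain s where X: "X \<in> borel_measurable P"
    and s: "\<And>n. Bochner_Integration.simple_bochner_integrable P (s n)"
    and lim: "(\<lambda>n. \<integral>\<^sup>+\<omega>. norm (X \<omega> - s n \<omega>) \<partial>P) \<longlonglongrightarrow> 0"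
    and e: "(\<lambda>n. Bochner_Integration.simple_bochner_integral P (s n)) \<longlonglongrightarrow> e"
    using assms unfolding has_expectation_def by blast
  have meas: "(\<lambda>\<omega>. norm (X \<omega> - s n \<omega>)) \<in> borel_measurable P" for n
    using s[of n] by (intro borel_measurable_norm_diff_simple X) (simp add: simple_bochner_integrable.simps)
  show ?thesis
  proof (rule has_bochner_integral.intros[where s = "\<lambda>n \<omega>. inner (s n \<omega>) h"])
    show "(\<lambda>\<omega>. inner (X \<omega>) h) \<in> borel_measurable P"
      by (rule measurable_compose[OF X]) (intro borel_measurable_continuous_onI continuous_intros)
    show "Bochner_Integration.simple_bochner_integrable P (\<lambda>\<omega>. inner (s n \<omega>) h)" for n
      using simple_bochner_integrable_compose2[OF _ s[of n] s[of n], of "\<lambda>x y. inner x h"] by simp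
    have "Bochner_Integration.simple_bochner_integral P (\<lambda>\<omega>. inner (s n \<omega>) h)
        = inner (Bochner_Integration.simple_bochner_integral P (s n)) h" for n
      by (intro simple_bochner_integral_linear s linearI) (simp_all add: inner_left_distrib)
    then show "(\<lambda>n. Bochner_Integration.simple_bochner_integral P (\<lambda>\<omega>. inner (s n \<omega>) h)) \<longlonglongrightarrow> inner e h"
      using e by (auto intro!: tendsto_intros)
    show "(\<lambda>n. \<integral>\<^sup>+\<omega>. norm (inner (X \<omega>) h - inner (s n \<omega>) h) \<partial>P) \<longlonglongrightarrow> 0"
    proof (rule tendsto_sandwich[OF _ _ tendsto_const])
      have "(\<lambda>n. ennreal (norm h) * (\<integral>\<^sup>+\<omega>. norm (X \<omega> - s n \<omega>) \<partial>P)) \<longlonglongrightarrow> ennreal (norm h) * 0"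
        by (intro ennreal_tendsto_cmult lim) simp
      then show "(\<lambda>n. ennreal (norm h) * (\<integral>\<^sup>+\<omega>. norm (X \<omega> - s n \<omega>) \<partial>P)) \<longlonglongrightarrow> 0"
        by simp
      have "(\<integral>\<^sup>+\<omega>. norm (inner (X \<omega>) h - inner (s n \<omega>) h) \<partial>P)
          \<le> (\<integral>\<^sup>+\<omega>. ennreal (norm h) * ennreal (norm (X \<omega> - s n \<omega>)) \<partial>P)" for n
      proof (rule nn_integral_mono)
        fix \<omega>
        have "norm (inner (X \<omega>) h - inner (s n \<omega>) h) \<le> norm h * norm (X \<omega> - s n \<omega>)"
          using Cauchy_Schwarz_ineq2[of "X \<omega> - s n \<omega>" h] by (simp add: inner_diff_left mult.commute)
        then show "ennreal (norm (inner (X \<omega>) h - inner (s n \<omega>) h)) \<le> ennreal (norm h) * ennreal (norm (X \<omega> - s n \<omega>))"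
          by (simp add: ennreal_leI flip: ennreal_mult)
      qed
      also have "(\<integral>\<^sup>+\<omega>. ennreal (norm h) * ennreal (norm (X \<omega> - s n \<omega>)) \<partial>P)
          = ennreal (norm h) * (\<integral>\<^sup>+\<omega>. norm (X \<omega> - s n \<omega>) \<partial>P)" for n
        using meas[of n] by (intro nn_integral_cmult) simp
      finally show "\<forall>\<^sub>F n in sequentially. (\<integral>\<^sup>+\<omega>. norm (inner (X \<omega>) h - inner (s n \<omega>) h) \<partial>P)
          \<le> ennreal (norm h) * (\<integral>\<^sup>+\<omega>. norm (X \<omega> - s n \<omega>) \<partial>P)"
        by simp
    qed simp
  qed
qed

text \<open>An expectation is determined by its inner products with fixed vectors.\<close>

lemma expected_eq:
  fixes X :: "'w \<Rightarrow> 'a::real_inner"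
  assumes "has_expectation P X e"
  shows "expected P X = e"
  unfolding expected_def
proof (rule the_equality)
  show "has_expectation P X e" by fact
next
  fix e' assume "has_expectation P X e'"
  then have "inner e' (e' - e) = inner e (e' - e)"
    using has_bochner_integral_eq[OF has_expectation_inner has_expectation_inner] assms by blast
  then show "e' = e"
    by (metis inner_diff_left inner_eq_zero_iff right_minus_eq)
qed

text \<open>The question is reduced to the real functions \<open>norm (X - s n)\<close>: their integrals tend to \<open>0\<close> by
  dominated convergence, which makes the integrals of the \<open>s n\<close> a Cauchy sequence.\<close>

lemma (in prob_space) has_expectation_limit:
  fixes X :: "'a \<Rightarrow> 'b::{real_normed_vector, complete_space}"
  assumes s: "\<And>n. simple_function M (s n)"
    and lim: "\<And>\<omega>. \<omega> \<in> space M \<Longrightarrow> (\<lambda>n. s n \<omega>) \<longlonglongrightarrow> X \<omega>"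
    and bound: "\<And>n \<omega>. \<omega> \<in> space M \<Longrightarrow> norm (s n \<omega>) \<le> B"
  shows "X \<in> borel_measurable M" and "\<exists>e. has_expectation M X e"
proof -
  let ?sI = "Bochner_Integration.simple_bochner_integral M"
  show X: "X \<in> borel_measurable M"
    using borel_measurable_simple_function[OF s] lim by (rule borel_measurable_LIMSEQ_metric)
  have sint: "Bochner_Integration.simple_bochner_integrable M (s n)" for n
    using s by (intro simple_bochner_integrable.intros) auto
  have bX: "norm (X \<omega>) \<le> B" if "\<omega> \<in> space M" for \<omega>
    using lim[OF that] bound[OF that] by (intro LIMSEQ_le_const2[OF tendsto_norm]) auto
  have le: "norm (X \<omega> - s n \<omega>) \<le> 2 * B" if "\<omega> \<in> space M" for n \<omega>
    using bX[OF that] bound[OF that, of n] norm_triangle_ineq4[of "X \<omega>" "s n \<omega>"] by linarith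
  have [measurable]: "(\<lambda>\<omega>. norm (X \<omega> - s n \<omega>)) \<in> borel_measurable M" for n
    by (intro borel_measurable_norm_diff_simple X s)
  have int: "integrable M (\<lambda>\<omega>. norm (X \<omega> - s n \<omega>))" for n
    using le by (intro integrable_const_bound[where B = "2 * B"]) (auto intro!: AE_I2)
  define d where "d n = (\<integral>\<omega>. norm (X \<omega> - s n \<omega>) \<partial>M)" for n
  have "(\<lambda>n. \<integral>\<omega>. norm (X \<omega> - s n \<omega>) \<partial>M) \<longlonglongrightarrow> (\<integral>\<omega>. 0 \<partial>M)"
  proof (rule integral_dominated_convergence[where w = "\<lambda>_. 2 * B"])
    have "(\<lambda>n. norm (X \<omega> - s n \<omega>)) \<longlonglongrightarrow> norm (X \<omega> - X \<omega>)" if "\<omega> \<in> space M" for \<omega>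
      by (intro tendsto_intros lim that)
    then show "AE \<omega> in M. (\<lambda>n. norm (X \<omega> - s n \<omega>)) \<longlonglongrightarrow> 0"
      by (auto intro!: AE_I2)
  qed (use le in \<open>auto intro!: AE_I2\<close>)
  then have d: "d \<longlonglongrightarrow> 0"
    by (simp add: d_def[abs_def])
  have diff: "norm (?sI (s m) - ?sI (s n)) \<le> d m + d n" for m n
  proof -
    have "Bochner_Integration.simple_bochner_integrable M (\<lambda>\<omega>. s m \<omega> - s n \<omega>)"
      "Bochner_Integration.simple_bochner_integrable M (\<lambda>\<omega>. norm (s m \<omega> - s n \<omega>))"
      using simple_bochner_integrable_compose2[OF _ sint[of m] sint[of n], of "\<lambda>x y. x - y"]
        simple_bochner_integrable_compose2[OF _ sint[of m] sint[of n], of "\<lambda>x y. norm (x - y)"]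
      by simp_all
    note dint = this
    have "norm (?sI (s m) - ?sI (s n)) = norm (?sI (\<lambda>\<omega>. s m \<omega> - s n \<omega>))"
      by (simp add: simple_bochner_integral_diff sint)
    also have "\<dots> \<le> Bochner_Integration.simple_bochner_integral M (\<lambda>\<omega>. norm (s m \<omega> - s n \<omega>))"
      by (intro simple_bochner_integral_norm_bound dint)
    also have "\<dots> = (\<integral>\<omega>. norm (s m \<omega> - s n \<omega>) \<partial>M)"
      using dint(2) by (rule simple_bochner_integrable_eq_integral)
    also have "\<dots> \<le> (\<integral>\<omega>. norm (X \<omega> - s m \<omega>) + norm (X \<omega> - s n \<omega>) \<partial>M)"
    proof (rule integral_mono)
      show "integrable M (\<lambda>\<omega>. norm (s m \<omega> - s n \<omega>))"
        using dint(2) by (rule has_bochner_integral_simple_bochner_integrable[THEN integrable.intros])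
      show "norm (s m \<omega> - s n \<omega>) \<le> norm (X \<omega> - s m \<omega>) + norm (X \<omega> - s n \<omega>)" for \<omega>
        using norm_triangle_ineq4[of "X \<omega> - s n \<omega>" "X \<omega> - s m \<omega>"] by simp
    qed (intro Bochner_Integration.integrable_add int)
    also have "\<dots> = d m + d n"
      by (simp add: d_def int)
    finally show ?thesis .
  qed
  have "Cauchy (\<lambda>n. ?sI (s n))"
  proof (rule metric_CauchyI)
    fix e :: real assume "0 < e"
    then have "\<forall>\<^sub>F n in sequentially. d n < e / 2"
      using d by (intro order_tendstoD(2)) auto
    then obtain N where N: "\<And>n. n \<ge> N \<Longrightarrow> d n < e / 2"
      by (auto simp: eventually_sequentially)
    have "dist (?sI (s m)) (?sI (s n)) < e" if "m \<ge> N" "n \<ge> N" for m n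
      using diff[of m n] N[OF that(1)] N[OF that(2)] by (simp add: dist_norm)
    then show "\<exists>N. \<forall>m\<ge>N. \<forall>n\<ge>N. dist (?sI (s m)) (?sI (s n)) < e" by blast
  qed
  then obtain e where e: "(\<lambda>n. ?sI (s n)) \<longlonglongrightarrow> e"
    using Cauchy_convergent convergent_def by blast
  have "(\<integral>\<^sup>+\<omega>. norm (X \<omega> - s n \<omega>) \<partial>M) = ennreal (d n)" for n
    unfolding d_def by (intro nn_integral_eq_integral int) auto
  moreover have "(\<lambda>n. ennreal (d n)) \<longlonglongrightarrow> 0"
    using tendsto_ennrealI[OF d] by simp
  ultimately have "(\<lambda>n. \<integral>\<^sup>+\<omega>. norm (X \<omega> - s n \<omega>) \<partial>M) \<longlonglongrightarrow> 0"
    by simp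
  then have "has_expectation M X e"
    unfolding has_expectation_def using X sint e by blast
  then show "\<exists>e. has_expectation M X e" ..
qed

text \<open>The variance is the least mean squared distance to a fixed vector.\<close>

lemma (in metric_operator) Var_M_le:
  assumes P: "prob_space P" and e: "has_expectation P X e"
    and int: "integrable P (\<lambda>\<omega>. (nM (X \<omega>))\<^sup>2)"
  shows "Var_M M P X \<le> (\<integral>\<omega>. (nM (X \<omega> - y))\<^sup>2 \<partial>P)"
proof -
  interpret P: prob_space P by fact
  have i: "integrable P (\<lambda>\<omega>. ip (X \<omega>) y)" "(\<integral>\<omega>. ip (X \<omega>) y \<partial>P) = ip e y"
    using has_expectation_inner[OF e, of "M y"]
    by (simp_all add: inner_M_def has_bochner_integral_iff)
  have "(\<integral>\<omega>. (nM (X \<omega> - y))\<^sup>2 \<partial>P) = (\<integral>\<omega>. (nM (X \<omega>))\<^sup>2 - 2 * ip (X \<omega>) y + (nM y)\<^sup>2 \<partial>P)"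
    by (simp only: nM_sq_diff)
  also have "\<dots> = (\<integral>\<omega>. (nM (X \<omega>))\<^sup>2 \<partial>P) - 2 * ip e y + (nM y)\<^sup>2"
    using int i by (simp add: P.prob_space)
  also have "\<dots> = Var_M M P X + (nM (e - y))\<^sup>2"
    by (simp add: Var_M_def expected_eq[OF e] nM_sq_diff)
  finally show ?thesis by simp
qed

section \<open>Independence of the present from the past\<close>

text \<open>Tonelli's theorem for the pair of past and present. The past is encoded as a sequence that is
  zero from the \<open>k\<close>-th entry on: on the space of all sequences the product \<open>\<sigma>\<close>-algebra is the Borel
  one, so that continuous functions of past and present qualify as \<open>f\<close>.\<close>

lemma (in prob_space) nn_integral_past_present:
  fixes I :: "nat \<Rightarrow> 'a \<Rightarrow> 'b::{second_countable_topology, zero}"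
    and f :: "(nat \<Rightarrow> 'b) \<times> 'b \<Rightarrow> ennreal"
  assumes indep: "indep_vars (\<lambda>_. borel) I UNIV" and f: "f \<in> borel_measurable borel"
  defines "past \<equiv> \<lambda>k \<omega> j. if j < k then I j \<omega> else 0"
  shows "(\<integral>\<^sup>+\<omega>. f (past k \<omega>, I k \<omega>) \<partial>M)
    = (\<integral>\<^sup>+\<omega>. (\<integral>\<^sup>+s. f (past k \<omega>, s) \<partial>distr M borel (I k)) \<partial>M)"
proof -
  let ?S = "PiM UNIV (\<lambda>_. borel) :: (nat \<Rightarrow> 'b) measure"
  let ?R = "PiM {k} (\<lambda>_. borel) :: (nat \<Rightarrow> 'b) measure"
  let ?now = "\<lambda>\<omega>. restrict (\<lambda>i. I i \<omega>) {k}"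
  have "indep_var ?S ((\<lambda>x j. if j < k then x j else 0) \<circ> (\<lambda>\<omega>. restrict (\<lambda>i. I i \<omega>) {..<k}))
      ?R ((\<lambda>x. x) \<circ> ?now)"
  proof (rule indep_var_compose[OF indep_var_restrict[OF indep]])
    show "(\<lambda>x j. if j < k then x j else 0) \<in> measurable (PiM {..<k} (\<lambda>_. borel)) ?S"
    proof (rule measurable_PiM_single')
      show "(\<lambda>x. if j < k then x j else 0) \<in> measurable (PiM {..<k} (\<lambda>_. borel :: 'b measure)) borel" for j
        by (cases "j < k") (auto intro: measurable_component_singleton)
    qed auto
  qed auto
  moreover have "(\<lambda>x j. if j < k then x j else 0) \<circ> (\<lambda>\<omega>. restrict (\<lambda>i. I i \<omega>) {..<k}) = past k"
    by (auto simp: past_def fun_eq_iff)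
  ultimately have "indep_var ?S (past k) ?R ?now"
    by (simp add: comp_def)
  then have rv: "random_variable ?S (past k)" "random_variable ?R ?now"
    and joint: "distr M ?S (past k) \<Otimes>\<^sub>M distr M ?R ?now
      = distr M (?S \<Otimes>\<^sub>M ?R) (\<lambda>\<omega>. (past k \<omega>, ?now \<omega>))"
    unfolding indep_var_distribution_eq by blast+
  have Ik: "random_variable borel (I k)"
    using indep unfolding indep_vars_def2 by blast
  have "sets (?S \<Otimes>\<^sub>M (borel :: 'b measure)) = sets (borel \<Otimes>\<^sub>M borel)"
    by (intro sets_pair_measure_cong sets_PiM_equal_borel refl)
  then have "sets (?S \<Otimes>\<^sub>M (borel :: 'b measure)) = sets (borel :: ((nat \<Rightarrow> 'b) \<times> 'b) measure)"
    unfolding borel_prod .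
  then have f': "f \<in> borel_measurable (?S \<Otimes>\<^sub>M borel)"
    using f measurable_cong_sets by blast
  have at_k: "(\<lambda>y. y k) \<in> measurable ?R borel"
    by (rule measurable_component_singleton) simp
  have g: "(\<lambda>z. f (fst z, snd z k)) \<in> borel_measurable (?S \<Otimes>\<^sub>M ?R)"
    by (rule measurable_compose[OF _ f'])
       (intro measurable_Pair measurable_fst measurable_compose[OF measurable_snd at_k])
  interpret R: prob_space "distr M ?R ?now"
    by (rule prob_space_distr) (rule rv)
  have f_slice: "(\<lambda>s. f (x, s)) \<in> borel_measurable borel" for x
    by (rule measurable_compose[OF _ f']) (auto simp: space_PiM)
  have "(\<integral>\<^sup>+\<omega>. f (past k \<omega>, I k \<omega>) \<partial>M)
      = (\<integral>\<^sup>+z. f (fst z, snd z k) \<partial>distr M (?S \<Otimes>\<^sub>M ?R) (\<lambda>\<omega>. (past k \<omega>, ?now \<omega>)))"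
    using rv g by (subst nn_integral_distr) auto
  also have "\<dots> = (\<integral>\<^sup>+z. f (fst z, snd z k) \<partial>(distr M ?S (past k) \<Otimes>\<^sub>M distr M ?R ?now))"
    by (simp only: joint)
  also have "\<dots> = (\<integral>\<^sup>+x. \<integral>\<^sup>+y. f (x, y k) \<partial>distr M ?R ?now \<partial>distr M ?S (past k))"
    using g by (subst R.nn_integral_fst[symmetric]) (simp_all cong: measurable_cong_sets sets_pair_measure_cong)
  also have "\<dots> = (\<integral>\<^sup>+\<omega>. \<integral>\<^sup>+y. f (past k \<omega>, y k) \<partial>distr M ?R ?now \<partial>M)"
    using rv(1) g R.borel_measurable_nn_integral[of "\<lambda>x y. f (x, y k)" ?S]
    by (intro nn_integral_distr)
       (simp_all add: case_prod_unfold cong: measurable_cong_sets sets_pair_measure_cong)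
  also have "\<dots> = (\<integral>\<^sup>+\<omega>. (\<integral>\<^sup>+s. f (past k \<omega>, s) \<partial>distr M borel (I k)) \<partial>M)"
    using rv(2) Ik f_slice
    by (intro nn_integral_cong) (simp add: nn_integral_distr measurable_compose[OF at_k])
  finally show ?thesis .
qed

section \<open>Limits\<close>

lemma cesaro_mean:
  fixes b :: "nat \<Rightarrow> real"
  assumes "b \<longlonglongrightarrow> l"
  shows "(\<lambda>n. (\<Sum>k<n. b k) / real n) \<longlonglongrightarrow> l"
proof (rule LIMSEQ_I)
  fix r :: real assume r: "0 < r"
  obtain N where N: "\<And>k. k \<ge> N \<Longrightarrow> norm (b k - l) < r / 2"
    using LIMSEQ_D[OF assms, of "r / 2"] r by auto
  define S where "S = (\<Sum>k<N. \<bar>b k - l\<bar>)"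
  have "norm ((\<Sum>k<n. b k) / real n - l) < r" if n: "n \<ge> Suc (N + nat \<lceil>2 * S / r\<rceil>)" for n
  proof -
    have "2 * S / r \<le> real (nat \<lceil>2 * S / r\<rceil>)"
      by (rule real_nat_ceiling_ge)
    then have "2 * S / r < real n"
      using n by linarith
    then have S: "S < real n * (r / 2)"
      using r by (simp add: field_simps)
    have npos: "real n > 0" using n by simp
    have "(\<Sum>k<n. b k) / real n - l = (\<Sum>k<n. b k - l) / real n"
      using npos by (simp add: sum_subtractf field_simps)
    then have eq: "norm ((\<Sum>k<n. b k) / real n - l) = \<bar>\<Sum>k<n. b k - l\<bar> / real n"
      by simp
    have "\<bar>\<Sum>k<n. b k - l\<bar> \<le> (\<Sum>k<n. \<bar>b k - l\<bar>)"
      by (rule sum_abs)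
    also have "\<dots> = S + (\<Sum>k\<in>{N..<n}. \<bar>b k - l\<bar>)"
      unfolding S_def using n by (intro sum.atLeastLessThan_concat[of 0 N n, symmetric, simplified atLeast0LessThan]) auto
    also have "\<dots> \<le> S + (\<Sum>k\<in>{N..<n}. r / 2)"
      using N by (intro add_left_mono sum_mono) (auto intro: less_imp_le)
    also have "\<dots> \<le> S + real n * (r / 2)"
      using r by (auto intro!: mult_right_mono)
    also have "\<dots> < real n * r"
      using S by linarith
    finally show ?thesis
      unfolding eq using npos by (simp add: pos_divide_less_eq mult.commute)
  qed
  then show "\<exists>no. \<forall>n\<ge>no. norm ((\<Sum>k<n. b k) / real n - l) < r" by blast
qed

lemma limsup_ereal_le_of_eventually_le:
  fixes f g :: "nat \<Rightarrow> real"
  assumes "\<And>k. k > 0 \<Longrightarrow> f k \<le> g k" and "g \<longlonglongrightarrow> l"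
  shows "limsup (\<lambda>k. ereal (f k)) \<le> ereal l"
proof -
  have "limsup (\<lambda>k. ereal (f k)) \<le> limsup (\<lambda>k. ereal (g k))"
    by (intro Limsup_mono eventually_mono[OF eventually_gt_at_top[of 0]]) (simp add: assms(1))
  also have "\<dots> = ereal l"
    using assms(2) by (intro lim_imp_Limsup) auto
  finally show ?thesis .
qed

section \<open>One random step\<close>

locale random_selection = relaxed_iteration M \<theta> T v \<alpha> + direct_sum H
  for M :: "'a::{real_inner, complete_space} \<Rightarrow> 'a" and \<theta> T v \<alpha>
    and H :: "'m::finite \<Rightarrow> 'a set" +
  fixes D :: "(real ^ 'm) measure" and \<beta> :: real
  assumes prob_D: "prob_space D" and sets_D: "sets D = sets borel"
    and unit_cube: "AE s in D. \<forall>i. 0 \<le> s $ i \<and> s $ i \<le> 1"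
    and mean: "(\<integral>s. s \<partial>D) = \<alpha> *\<^sub>R 1"
    and \<beta>_less: "\<beta> < \<alpha> / \<theta>"
    and second_moment: "(\<integral>s. (nM (select H s u))\<^sup>2 \<partial>D) \<le> \<beta> * (nM u)\<^sup>2"
begin

sublocale D: prob_space D
  by (rule prob_D)

lemma measurable_D [measurable]: "(\<lambda>s. s $ i) \<in> borel_measurable D"
  unfolding measurable_cong_sets[OF sets_D refl]
  by (intro borel_measurable_continuous_onI continuous_intros)

lemma integrable_entry: "integrable D (\<lambda>s. s $ i)"
  using unit_cube by (intro D.integrable_const_bound[where B = 1]) auto

lemma integrable_entries: "integrable D (\<lambda>s. s $ i * s $ j)"
  using unit_cube by (intro D.integrable_const_bound[where B = 1]) (auto simp: abs_mult intro!: mult_le_one)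

lemma integral_entry: "(\<integral>s. s $ i \<partial>D) = \<alpha>"
proof -
  have "AE s in D. norm s \<le> CARD('m)"
    using unit_cube
  proof eventually_elim
    case (elim s)
    have "norm s \<le> (\<Sum>i\<in>UNIV. \<bar>s $ i\<bar>)"
      by (rule norm_le_l1_cart)
    also have "\<dots> \<le> (\<Sum>i\<in>(UNIV::'m set). 1)"
      using elim by (intro sum_mono) auto
    finally show ?case by simp
  qed
  then have "integrable D (\<lambda>s. s)"
    by (rule D.integrable_const_bound) (simp add: measurable_cong_sets[OF sets_D refl])
  then have "(\<integral>s. s $ i \<partial>D) = (\<integral>s. s \<partial>D) $ i"
    by (rule integral_bounded_linear[OF bounded_linear_vec_nth])
  then show ?thesis
    by (simp add: mean)
qed

lemma integrable_ip_select: "integrable D (\<lambda>s. ip (select H s u) y)"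
  and integral_ip_select: "(\<integral>s. ip (select H s u) y \<partial>D) = \<alpha> * ip u y"
proof -
  have eq: "ip (select H s u) y = (\<Sum>i\<in>UNIV. s $ i * ip (block H i u) y)" for s
    by (simp add: select_def ip_sum_left ip_simps)
  show "integrable D (\<lambda>s. ip (select H s u) y)"
    unfolding eq by (intro Bochner_Integration.integrable_sum integrable_mult_left integrable_entry)
  have "(\<integral>s. ip (select H s u) y \<partial>D) = (\<Sum>i\<in>UNIV. \<alpha> * ip (block H i u) y)"
    unfolding eq by (subst Bochner_Integration.integral_sum) (simp_all add: integrable_entry integral_entry)
  also have "\<dots> = \<alpha> * ip (\<Sum>i\<in>UNIV. block H i u) y"
    by (simp add: ip_sum_left sum_distrib_left)
  finally show "(\<integral>s. ip (select H s u) y \<partial>D) = \<alpha> * ip u y"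
    by (simp add: sum_block)
qed

lemma integrable_nM_select: "integrable D (\<lambda>s. (nM (select H s u))\<^sup>2)"
proof -
  have eq: "(nM (select H s u))\<^sup>2
      = (\<Sum>i\<in>UNIV. \<Sum>j\<in>UNIV. s $ i * s $ j * ip (block H j u) (block H i u))" for s
    by (simp add: select_def nM_sq ip_sum_left ip_sum_right ip_simps sum_distrib_left mult.assoc)
  show ?thesis
    unfolding eq by (intro Bochner_Integration.integrable_sum integrable_mult_left integrable_entries)
qed

lemma integrable_nM_diff_select: "integrable D (\<lambda>s. (nM (y - select H s u))\<^sup>2)"
  unfolding nM_sq_diff ip_commute[of y]
  by (intro Bochner_Integration.integrable_add Bochner_Integration.integrable_diff
      integrable_mult_right integrable_ip_select integrable_nM_select) simp_all

lemma integral_nM_diff_select: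
  "(\<integral>s. (nM (y - select H s u))\<^sup>2 \<partial>D) \<le> (nM y)\<^sup>2 - 2 * \<alpha> * ip u y + \<beta> * (nM u)\<^sup>2"
proof -
  have "(\<integral>s. (nM (y - select H s u))\<^sup>2 \<partial>D)
      = (nM y)\<^sup>2 - 2 * (\<alpha> * ip u y) + (\<integral>s. (nM (select H s u))\<^sup>2 \<partial>D)"
    unfolding nM_sq_diff ip_commute[of y]
    by (simp add: integrable_ip_select integrable_nM_select integral_ip_select D.prob_space)
  then show ?thesis
    using second_moment[of u] by simp
qed

text \<open>Jensen's inequality: the mean of \<open>select H s u\<close> is \<open>\<alpha> u\<close>.\<close>

lemma excess_nonneg: "0 \<le> (\<beta> - \<alpha>\<^sup>2) * (nM u)\<^sup>2"
proof -
  have "0 \<le> (\<integral>s. (nM (\<alpha> *\<^sub>R u - select H s u))\<^sup>2 \<partial>D)"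
    by simp
  also have "\<dots> \<le> (\<beta> - \<alpha>\<^sup>2) * (nM u)\<^sup>2"
    using integral_nM_diff_select[of "\<alpha> *\<^sub>R u" u]
    by (simp add: nM_scaleR ip_simps nM_sq[symmetric] power_mult_distrib) (simp add: power2_eq_square algebra_simps)
  finally show ?thesis .
qed

text \<open>A non-zero vector in the previous bound gives \<open>\<alpha>\<^sup>2 \<le> \<beta> < \<alpha> / \<theta>\<close>, so that \<open>\<alpha> \<theta> < 1\<close>.\<close>

lemma disp_reference_tendsto: "(\<lambda>k. nM (disp ((G ^^ k) z) - v)) \<longlonglongrightarrow> 0"
proof (cases "\<exists>u::'a. u \<noteq> 0")
  case True
  then obtain u :: 'a where "u \<noteq> 0" by blast
  then have "0 < (nM u)\<^sup>2" by simp
  then have "\<alpha>\<^sup>2 \<le> \<beta>"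
    using excess_nonneg[of u] by (simp add: zero_le_mult_iff)
  then have "\<alpha> * \<alpha> < \<alpha> * (1 / \<theta>)"
    using \<beta>_less by (simp add: power2_eq_square)
  then have "\<alpha> * \<theta> < 1"
    using \<alpha>_pos \<theta>_pos by (simp add: field_simps)
  then show ?thesis
    by (rule disp_G_pow_tendsto)
next
  case False
  then have "disp ((G ^^ k) z) - v = 0" for k
    by blast
  then show ?thesis by simp
qed

text \<open>Moving the reference point by this vector absorbs, by completing the square, the cross term
  \<open>2 (\<beta> - \<alpha>\<^sup>2) ip v (disp x - disp z)\<close> arising in one step.\<close>

definition offset :: 'a where
  "offset = ((\<beta> - \<alpha>\<^sup>2) / \<alpha>) *\<^sub>R v"

definition growth :: "'a \<Rightarrow> real" where
  "growth z = (\<beta> - \<alpha>\<^sup>2) * (nM (disp z))\<^sup>2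
    + (\<beta> - \<alpha>\<^sup>2)\<^sup>2 / (\<alpha> / \<theta> - \<beta>) * (nM (disp z - v))\<^sup>2"

lemma growth_nonneg: "0 \<le> growth z"
  using excess_nonneg[of "disp z"] \<beta>_less by (simp add: growth_def)

lemma growth_tendsto: "(\<lambda>k. growth ((G ^^ k) z)) \<longlonglongrightarrow> (\<beta> - \<alpha>\<^sup>2) * (nM v)\<^sup>2"
proof -
  have "(\<lambda>k. nM (disp ((G ^^ k) z)) - nM v) \<longlonglongrightarrow> 0"
  proof (rule Lim_null_comparison[OF always_eventually disp_reference_tendsto], rule allI)
    fix k
    show "norm (nM (disp ((G ^^ k) z)) - nM v) \<le> nM (disp ((G ^^ k) z) - v)"
      using nM_triangle[of "disp ((G ^^ k) z) - v" v] nM_v_le[of "(G ^^ k) z"] by simp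
  qed
  then have "(\<lambda>k. nM (disp ((G ^^ k) z))) \<longlonglongrightarrow> nM v"
    by (rule LIM_zero_cancel)
  then have "(\<lambda>k. growth ((G ^^ k) z)) \<longlonglongrightarrow> (\<beta> - \<alpha>\<^sup>2) * (nM v)\<^sup>2
      + (\<beta> - \<alpha>\<^sup>2)\<^sup>2 / (\<alpha> / \<theta> - \<beta>) * 0\<^sup>2"
    unfolding growth_def by (intro tendsto_intros disp_reference_tendsto)
  then show ?thesis by simp
qed

text \<open>With \<open>d = disp x - disp z\<close>, the mean square splits into the old squared distance, the
  cocoercivity term \<open>- 2 \<alpha> ip (x - z) d \<le> - (\<alpha> / \<theta>) (nM d)\<^sup>2\<close>, the second moment, and inner
  products of \<open>d\<close> with \<open>disp z\<close> and with the offset; the last two combine to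
  \<open>2 (\<beta> - \<alpha>\<^sup>2) ip (disp z - v) d\<close>, which the surplus \<open>(\<alpha> / \<theta> - \<beta>) (nM d)\<^sup>2\<close> absorbs.\<close>

lemma one_step:
  "(\<integral>s. (nM (x - select H s (disp x) - (G z - offset)))\<^sup>2 \<partial>D)
    \<le> (nM (x - (z - offset)))\<^sup>2 + growth z"
proof -
  define c where "c = \<beta> - \<alpha>\<^sup>2"
  define \<delta> where "\<delta> = \<alpha> / \<theta> - \<beta>"
  define u where "u = disp z"
  define d where "d = disp x - disp z"
  define e where "e = x - z + offset"
  have \<delta>: "\<delta> > 0"
    using \<beta>_less by (simp add: \<delta>_def)
  have w: "disp x = u + d"
    by (simp add: u_def d_def)
  have eq: "x - select H s (disp x) - (G z - offset) = (e + \<alpha> *\<^sub>R u) - select H s (disp x)" for s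
    by (simp add: e_def u_def G_def algebra_simps)
  have "(\<integral>s. (nM (x - select H s (disp x) - (G z - offset)))\<^sup>2 \<partial>D)
      \<le> (nM (e + \<alpha> *\<^sub>R u))\<^sup>2 - 2 * \<alpha> * ip (disp x) (e + \<alpha> *\<^sub>R u) + \<beta> * (nM (disp x))\<^sup>2"
    unfolding eq by (rule integral_nM_diff_select)
  also have "\<dots> = (nM e)\<^sup>2 - 2 * \<alpha> * ip e d + c * (nM u)\<^sup>2 + 2 * c * ip u d + \<beta> * (nM d)\<^sup>2"
    unfolding nM_sq c_def w
    by (simp add: ip_simps ip_commute[of u e] ip_commute[of d e] ip_commute[of d u] power2_eq_square algebra_simps)
  also have "2 * \<alpha> * ip e d = 2 * \<alpha> * ip (x - z) d + 2 * c * ip v d"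
  proof -
    have "\<alpha> * ip offset d = c * ip v d"
      using \<alpha>_pos by (simp add: offset_def ip_simps c_def)
    moreover have "2 * \<alpha> * ip e d = 2 * \<alpha> * ip (x - z) d + 2 * (\<alpha> * ip offset d)"
      by (simp add: e_def ip_simps algebra_simps)
    ultimately show ?thesis by simp
  qed
  also have "(nM e)\<^sup>2 - (2 * \<alpha> * ip (x - z) d + 2 * c * ip v d) + c * (nM u)\<^sup>2 + 2 * c * ip u d + \<beta> * (nM d)\<^sup>2
      = (nM e)\<^sup>2 + c * (nM u)\<^sup>2 - 2 * \<alpha> * ip (x - z) d + 2 * c * ip (u - v) d + \<beta> * (nM d)\<^sup>2"
    by (simp add: ip_simps algebra_simps)
  also have "\<dots> \<le> (nM e)\<^sup>2 + c * (nM u)\<^sup>2 - \<delta> * (nM d)\<^sup>2 + 2 * c * ip (u - v) d"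
  proof -
    have "(nM d)\<^sup>2 / \<theta> \<le> 2 * ip (x - z) d"
      using cocoercive[of x z] \<theta>_pos by (simp add: d_def field_simps)
    then have "\<alpha> * ((nM d)\<^sup>2 / \<theta>) \<le> \<alpha> * (2 * ip (x - z) d)"
      using \<alpha>_pos by (intro mult_left_mono) auto
    then show ?thesis
      by (simp add: \<delta>_def algebra_simps)
  qed
  also have "\<dots> \<le> (nM e)\<^sup>2 + c * (nM u)\<^sup>2 + c\<^sup>2 / \<delta> * (nM (u - v))\<^sup>2"
  proof -
    have "0 \<le> (nM ((c / \<delta>) *\<^sub>R (u - v) - d))\<^sup>2"
      by simp
    then have "0 \<le> \<delta> * (nM ((c / \<delta>) *\<^sub>R (u - v) - d))\<^sup>2"
      using \<delta> by (intro mult_nonneg_nonneg) auto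
    also have "\<dots> = c\<^sup>2 / \<delta> * (nM (u - v))\<^sup>2 - 2 * c * ip (u - v) d + \<delta> * (nM d)\<^sup>2"
      unfolding nM_sq_diff[of "(c / \<delta>) *\<^sub>R (u - v)"] nM_scaleR ip_simps(5)
      using \<delta> by (simp add: power_mult_distrib power2_eq_square field_simps)
    finally show ?thesis by simp
  qed
  finally show ?thesis
    by (simp add: growth_def c_def \<delta>_def u_def e_def algebra_simps)
qed

end

section \<open>The random iteration\<close>

lemma iterate_cong:
  assumes "\<And>j. j < k \<Longrightarrow> I j \<omega> = J j \<omega>'"
  shows "iterate H \<theta> T I x0 k \<omega> = iterate H \<theta> T J x0 k \<omega>'"
  using assms by (induction k) auto

locale random_iteration = random_selection M \<theta> T v \<alpha> H D \<beta> + P: prob_space P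
  for M :: "'a::{real_inner, complete_space} \<Rightarrow> 'a" and \<theta> T v \<alpha>
    and H :: "'m::finite \<Rightarrow> 'a set" and D \<beta> and P :: "'w measure" +
  fixes I :: "nat \<Rightarrow> 'w \<Rightarrow> real ^ 'm" and x0 :: 'a
  assumes indep: "P.indep_vars (\<lambda>_. borel) I UNIV"
    and distr_I: "distr P borel (I k) = D"
    and I_unit_cube: "\<omega> \<in> space P \<Longrightarrow> 0 \<le> I k \<omega> $ i \<and> I k \<omega> $ i \<le> 1"
begin

abbreviation X :: "nat \<Rightarrow> 'w \<Rightarrow> 'a" where
  "X \<equiv> iterate H \<theta> T I x0"

lemma iterate_Suc:
  "iterate H \<theta> T J x0 (Suc k) \<omega>
    = iterate H \<theta> T J x0 k \<omega> - select H (J k \<omega>) (disp (iterate H \<theta> T J x0 k \<omega>))"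
  using \<theta>_pos by (simp add: T_select_eq disp_def)

lemma continuous_on_iterate:
  "continuous_on UNIV (\<lambda>s. iterate H \<theta> T (\<lambda>j s. s j) x0 k s)"
proof (induction k)
  case (Suc k)
  show ?case
    unfolding iterate_Suc by (intro continuous_intros continuous_on_product_coordinates Suc.IH)
qed simp

text \<open>The bound has to be uniform in \<open>J\<close> and \<open>\<omega>\<close>; it dominates simple approximations of the iterates.\<close>

lemma iterate_bounded:
  "\<exists>B. \<forall>(J :: nat \<Rightarrow> 'x \<Rightarrow> real ^ 'm) \<omega>. (\<forall>j i. \<bar>J j \<omega> $ i\<bar> \<le> R) \<longrightarrow> norm (iterate H \<theta> T J x0 k \<omega>) \<le> B"
proof (induction k)
  case (Suc k)
  then obtain B where B: "\<And>(J :: nat \<Rightarrow> 'x \<Rightarrow> real ^ 'm) \<omega>. (\<And>j i. \<bar>J j \<omega> $ i\<bar> \<le> R)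
      \<Longrightarrow> norm (iterate H \<theta> T J x0 k \<omega>) \<le> B"
    by blast
  obtain L where L: "L > 0" "\<And>x y. norm (disp x - disp y) \<le> L * norm (x - y)"
    using disp_lipschitz by blast
  have "norm (iterate H \<theta> T J x0 (Suc k) \<omega>) \<le> B + CARD('m) * (R * (norm (disp 0) + L * B))"
    if J: "\<And>j i. \<bar>J j \<omega> $ i\<bar> \<le> R" for J :: "nat \<Rightarrow> 'x \<Rightarrow> real ^ 'm" and \<omega>
  proof -
    let ?x = "iterate H \<theta> T J x0 k \<omega>"
    have x: "norm ?x \<le> B"
      by (rule B) (rule J)
    have R: "0 \<le> R"
      by (rule order_trans[OF abs_ge_zero J])
    have "norm (disp ?x) \<le> norm (disp 0) + norm (disp ?x - disp 0)"
      using norm_triangle_ineq[of "disp 0" "disp ?x - disp 0"] by simp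
    also have "norm (disp ?x - disp 0) \<le> L * norm (?x - 0)"
      by (rule L)
    also have "\<dots> \<le> L * B"
      using L(1) x by simp
    finally have "norm (disp ?x) \<le> norm (disp 0) + L * B" by simp
    then have "CARD('m) * (R * norm (disp ?x)) \<le> CARD('m) * (R * (norm (disp 0) + L * B))"
      using R by (intro mult_left_mono) auto
    moreover have "norm (select H (J k \<omega>) (disp ?x)) \<le> CARD('m) * (R * norm (disp ?x))"
      by (rule norm_select_le) (rule J)
    moreover have "norm (iterate H \<theta> T J x0 (Suc k) \<omega>) \<le> norm ?x + norm (select H (J k \<omega>) (disp ?x))"
      unfolding iterate_Suc by (rule norm_triangle_ineq4)
    ultimately show ?thesis using x by linarith
  qed
  then show ?case by blast
qed auto

lemma measurable_I [measurable]: "I k \<in> borel_measurable P"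
  using indep unfolding P.indep_vars_def2 by blast

text \<open>Replacing the selection vectors by simple random vectors that converge to them gives simple
  approximations of the iterates.\<close>

lemma iterate_simple_approximation:
  "\<exists>s B. (\<forall>n. simple_function P (s n)) \<and> (\<forall>\<omega>\<in>space P. (\<lambda>n. s n \<omega>) \<longlonglongrightarrow> X k \<omega>)
     \<and> (\<forall>n. \<forall>\<omega>\<in>space P. norm (s n \<omega>) \<le> B)"
proof -
  have "\<forall>j. \<exists>F. (\<forall>n. simple_function P (F n)) \<and> (\<forall>\<omega>\<in>space P. (\<lambda>n. F n \<omega>) \<longlonglongrightarrow> I j \<omega>)
      \<and> (\<forall>n. \<forall>\<omega>\<in>space P. dist (F n \<omega>) 0 \<le> 2 * dist (I j \<omega>) 0)"
    by (intro allI borel_measurable_implies_sequence_metric measurable_I)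
  from choice[OF this] obtain F where F: "\<forall>j. (\<forall>n. simple_function P (F j n))
      \<and> (\<forall>\<omega>\<in>space P. (\<lambda>n. F j n \<omega>) \<longlonglongrightarrow> I j \<omega>)
      \<and> (\<forall>n. \<forall>\<omega>\<in>space P. dist (F j n \<omega>) 0 \<le> 2 * dist (I j \<omega>) 0)"
    by (elim exE)
  have simple: "simple_function P (F j n)" for j n
    using F by blast
  have lim: "(\<lambda>n. F j n \<omega>) \<longlonglongrightarrow> I j \<omega>" if "\<omega> \<in> space P" for j \<omega>
    using F that by blast
  have bound: "dist (F j n \<omega>) 0 \<le> 2 * dist (I j \<omega>) 0" if "\<omega> \<in> space P" for j n \<omega>
    using F that by blast
  define s where "s n k = iterate H \<theta> T (\<lambda>j. F j n) x0 k" for n k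
  have s_Suc: "s n (Suc k) \<omega> = s n k \<omega> - select H (F k n \<omega>) (disp (s n k \<omega>))" for n k \<omega>
    unfolding s_def by (rule iterate_Suc)
  have s_simple: "simple_function P (s n k)" for n k
  proof (induction k)
    case 0
    then show ?case by (simp add: s_def)
  next
    case (Suc k)
    show ?case
      using simple_function_compose2[OF Suc.IH simple[of k n], of "\<lambda>x t. x - select H t (disp x)"]
      by (simp add: s_Suc[abs_def])
  qed
  have s_lim: "(\<lambda>n. s n k \<omega>) \<longlonglongrightarrow> X k \<omega>" if \<omega>: "\<omega> \<in> space P" for k \<omega>
  proof (induction k)
    case (Suc k)
    have "continuous_on UNIV (\<lambda>(x, t). x - select H t (disp x))"
      by (auto simp: case_prod_unfold intro!: continuous_intros)
    from continuous_on_tendsto_compose[OF this tendsto_Pair[OF Suc.IH lim[OF \<omega>]]]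
    show ?case
      unfolding s_Suc iterate_Suc by simp
  qed (simp add: s_def)
  have "\<exists>B. \<forall>n. \<forall>\<omega>\<in>space P. norm (s n k \<omega>) \<le> B"
  proof -
    have R: "\<bar>F j n \<omega> $ i\<bar> \<le> 2 * CARD('m)" if \<omega>: "\<omega> \<in> space P" for j n i \<omega>
    proof -
      have "norm (I j \<omega>) \<le> (\<Sum>i\<in>UNIV. \<bar>I j \<omega> $ i\<bar>)"
        by (rule norm_le_l1_cart)
      also have "\<dots> \<le> (\<Sum>i\<in>(UNIV::'m set). 1)"
        using I_unit_cube[OF \<omega>] by (intro sum_mono) auto
      finally have "norm (I j \<omega>) \<le> CARD('m)" by simp
      then show ?thesis
        using bound[OF \<omega>, of j n] component_le_norm_cart[of "F j n \<omega>" i] by simp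
    qed
    obtain B where B: "\<And>(J :: nat \<Rightarrow> 'w \<Rightarrow> real ^ 'm) \<omega>. (\<And>j i. \<bar>J j \<omega> $ i\<bar> \<le> 2 * CARD('m))
        \<Longrightarrow> norm (iterate H \<theta> T J x0 k \<omega>) \<le> B"
      using iterate_bounded by blast
    have "norm (s n k \<omega>) \<le> B" if "\<omega> \<in> space P" for n \<omega>
      unfolding s_def by (rule B) (rule R[OF that])
    then show ?thesis by blast
  qed
  then obtain B where "\<forall>n. \<forall>\<omega>\<in>space P. norm (s n k \<omega>) \<le> B" ..
  then show ?thesis
    using s_simple s_lim by (intro exI[of _ "\<lambda>n. s n k"] exI[of _ B]) simp
qed

lemma measurable_X [measurable]: "X k \<in> borel_measurable P"
  using iterate_simple_approximation[of k] P.has_expectation_limit(1) by blast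

lemma has_expectation_scaled_X: "\<exists>e. has_expectation P (\<lambda>\<omega>. r *\<^sub>R X k \<omega>) e"
proof -
  obtain s B where s: "\<And>n. simple_function P (s n)"
    and lim: "\<And>\<omega>. \<omega> \<in> space P \<Longrightarrow> (\<lambda>n. s n \<omega>) \<longlonglongrightarrow> X k \<omega>"
    and B: "\<And>n \<omega>. \<omega> \<in> space P \<Longrightarrow> norm (s n \<omega>) \<le> B"
    using iterate_simple_approximation[of k] by blast
  show ?thesis
  proof (rule P.has_expectation_limit(2))
    show "simple_function P (\<lambda>\<omega>. r *\<^sub>R s n \<omega>)" for n
      by (rule simple_function_compose1[OF s])
    show "(\<lambda>n. r *\<^sub>R s n \<omega>) \<longlonglongrightarrow> r *\<^sub>R X k \<omega>" if "\<omega> \<in> space P" for \<omega>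
      by (intro tendsto_intros lim that)
    show "norm (r *\<^sub>R s n \<omega>) \<le> \<bar>r\<bar> * B" if "\<omega> \<in> space P" for n \<omega>
      using B[OF that] by (simp add: mult_left_mono)
  qed
qed

lemma measurable_nM_X [measurable]: "(\<lambda>\<omega>. (nM (X k \<omega> - y))\<^sup>2) \<in> borel_measurable P"
  by (rule measurable_compose[OF measurable_X])
     (intro borel_measurable_continuous_onI continuous_intros)

text \<open>The one-step bound with \<open>x\<close> replaced by the iterate, conditionally on the past. The iterate is a
  continuous function \<open>F\<close> of the past selection vectors, which provides the joint measurability.\<close>

lemma expected_step:
  "(\<integral>\<^sup>+\<omega>. (nM (X (Suc k) \<omega> - (G z - offset)))\<^sup>2 \<partial>P)
    \<le> (\<integral>\<^sup>+\<omega>. (nM (X k \<omega> - (z - offset)))\<^sup>2 \<partial>P) + ennreal (growth z)"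
proof -
  define F where "F = (\<lambda>s :: nat \<Rightarrow> real ^ 'm. iterate H \<theta> T (\<lambda>j s. s j) x0 k s)"
  define f where "f = (\<lambda>p. ennreal ((nM (F (fst p) - select H (snd p) (disp (F (fst p))) - (G z - offset)))\<^sup>2))"
  define past where "past = (\<lambda>\<omega> j. if j < k then I j \<omega> else 0)"
  have X_past: "X k \<omega> = F (past \<omega>)" for \<omega>
    unfolding F_def by (rule iterate_cong) (simp add: past_def)
  have F: "continuous_on UNIV F"
    unfolding F_def by (rule continuous_on_iterate)
  have "continuous_on UNIV (\<lambda>p. (nM (F (fst p) - select H (snd p) (disp (F (fst p))) - (G z - offset)))\<^sup>2)"
    by (intro continuous_intros continuous_on_compose2[OF F]) auto
  then have "f \<in> borel_measurable borel"
    unfolding f_def by (intro measurable_compose[OF borel_measurable_continuous_onI measurable_ennreal])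
  from P.nn_integral_past_present[OF indep this, of k]
  have "(\<integral>\<^sup>+\<omega>. f (past \<omega>, I k \<omega>) \<partial>P) = (\<integral>\<^sup>+\<omega>. (\<integral>\<^sup>+s. f (past \<omega>, s) \<partial>D) \<partial>P)"
    by (simp only: distr_I past_def)
  also have "\<dots> \<le> (\<integral>\<^sup>+\<omega>. ennreal ((nM (X k \<omega> - (z - offset)))\<^sup>2) + ennreal (growth z) \<partial>P)"
  proof (rule nn_integral_mono)
    fix \<omega>
    let ?x = "X k \<omega>"
    have "x - select H s (disp x) - (G z - offset) = (x - (G z - offset)) - select H s (disp x)" for x s
      by simp
    then have int: "integrable D (\<lambda>s. (nM (?x - select H s (disp ?x) - (G z - offset)))\<^sup>2)"
      using integrable_nM_diff_select by presburger
    have "(\<integral>\<^sup>+s. f (past \<omega>, s) \<partial>D) = (\<integral>\<^sup>+s. ennreal ((nM (?x - select H s (disp ?x) - (G z - offset)))\<^sup>2) \<partial>D)"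
      by (simp add: f_def X_past)
    also have "\<dots> = ennreal (\<integral>s. (nM (?x - select H s (disp ?x) - (G z - offset)))\<^sup>2 \<partial>D)"
      by (intro nn_integral_eq_integral int) simp
    also have "\<dots> \<le> ennreal ((nM (?x - (z - offset)))\<^sup>2 + growth z)"
      by (intro ennreal_leI one_step)
    also have "\<dots> = ennreal ((nM (?x - (z - offset)))\<^sup>2) + ennreal (growth z)"
      by (intro ennreal_plus growth_nonneg) simp
    finally show "(\<integral>\<^sup>+s. f (past \<omega>, s) \<partial>D) \<le> ennreal ((nM (?x - (z - offset)))\<^sup>2) + ennreal (growth z)" .
  qed
  also have "\<dots> = (\<integral>\<^sup>+\<omega>. (nM (X k \<omega> - (z - offset)))\<^sup>2 \<partial>P) + ennreal (growth z)"
    by (subst nn_integral_add) (simp_all add: P.emeasure_space_1)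
  finally show ?thesis
    unfolding iterate_Suc by (simp add: f_def X_past)
qed

definition total_growth :: "'a \<Rightarrow> nat \<Rightarrow> real" where
  "total_growth z k = (nM (x0 - (z - offset)))\<^sup>2 + (\<Sum>j<k. growth ((G ^^ j) z))"

lemma total_growth_nonneg: "0 \<le> total_growth z k"
  unfolding total_growth_def by (intro add_nonneg_nonneg sum_nonneg growth_nonneg) simp

lemma nn_integral_distance_le:
  "(\<integral>\<^sup>+\<omega>. (nM (X k \<omega> - ((G ^^ k) z - offset)))\<^sup>2 \<partial>P) \<le> ennreal (total_growth z k)"
proof (induction k)
  case 0
  then show ?case by (simp add: total_growth_def P.emeasure_space_1)
next
  case (Suc k)
  have "(\<integral>\<^sup>+\<omega>. (nM (X (Suc k) \<omega> - ((G ^^ Suc k) z - offset)))\<^sup>2 \<partial>P)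
      \<le> (\<integral>\<^sup>+\<omega>. (nM (X k \<omega> - ((G ^^ k) z - offset)))\<^sup>2 \<partial>P) + ennreal (growth ((G ^^ k) z))"
    using expected_step[of k "(G ^^ k) z"] by simp
  also have "\<dots> \<le> ennreal (total_growth z k) + ennreal (growth ((G ^^ k) z))"
    by (intro add_right_mono Suc.IH)
  also have "\<dots> = ennreal (total_growth z (Suc k))"
    by (simp add: total_growth_def ennreal_plus[symmetric] growth_nonneg sum_nonneg add.assoc del: ennreal_plus)
  finally show ?case .
qed

lemma integrable_distance: "integrable P (\<lambda>\<omega>. (nM (X k \<omega> - ((G ^^ k) z - offset)))\<^sup>2)"
proof (rule integrableI_bounded)
  show "(\<integral>\<^sup>+\<omega>. ennreal (norm ((nM (X k \<omega> - ((G ^^ k) z - offset)))\<^sup>2)) \<partial>P) < \<infinity>"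
    using nn_integral_distance_le[of k z] by (simp add: le_less_trans)
qed simp

lemma integral_distance_le:
  "(\<integral>\<omega>. (nM (X k \<omega> - ((G ^^ k) z - offset)))\<^sup>2 \<partial>P) \<le> total_growth z k"
  by (rule integral_real_bounded[OF total_growth_nonneg nn_integral_distance_le])

lemma total_growth_mean_tendsto: "(\<lambda>k. total_growth z k / real k) \<longlonglongrightarrow> (\<beta> - \<alpha>\<^sup>2) * (nM v)\<^sup>2"
proof -
  have "(\<lambda>k. (nM (x0 - (z - offset)))\<^sup>2 / real k + (\<Sum>j<k. growth ((G ^^ j) z)) / real k)
      \<longlonglongrightarrow> 0 + (\<beta> - \<alpha>\<^sup>2) * (nM v)\<^sup>2"
    by (intro tendsto_add lim_const_over_n cesaro_mean growth_tendsto)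
  then show ?thesis
    by (simp add: total_growth_def add_divide_distrib)
qed

lemma integrable_nM_X: "integrable P (\<lambda>\<omega>. (nM (X k \<omega> - y))\<^sup>2)"
proof (rule Bochner_Integration.integrable_bound)
  let ?y = "(G ^^ k) x0 - offset"
  show "integrable P (\<lambda>\<omega>. (1 + 1) * (nM (X k \<omega> - ?y))\<^sup>2 + (1 + 1 / 1) * (nM (?y - y))\<^sup>2)"
    by (intro Bochner_Integration.integrable_add integrable_mult_right integrable_distance) simp_all
  show "AE \<omega> in P. norm ((nM (X k \<omega> - y))\<^sup>2)
      \<le> norm ((1 + 1) * (nM (X k \<omega> - ?y))\<^sup>2 + (1 + 1 / 1) * (nM (?y - y))\<^sup>2)"
    using nM_sq_add_le[of 1 "X k _ - ?y" "?y - y"] by (intro AE_I2) simp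
qed simp

section \<open>Convergence rates\<close>

text \<open>The variance is at most the mean squared distance to the deterministic reference point.\<close>

lemma variance_rate:
  "limsup (\<lambda>k. ereal (real k * Var_M M P (\<lambda>\<omega>. (1 / real k) *\<^sub>R X k \<omega>)))
    \<le> ereal ((\<beta> - \<alpha>\<^sup>2) * (nM v)\<^sup>2)"
proof (rule limsup_ereal_le_of_eventually_le[OF _ total_growth_mean_tendsto[of x0]])
  fix k :: nat assume k: "k > 0"
  define y where "y = (G ^^ k) x0 - offset"
  obtain e where e: "has_expectation P (\<lambda>\<omega>. (1 / real k) *\<^sub>R X k \<omega>) e"
    using has_expectation_scaled_X by blast
  have "integrable P (\<lambda>\<omega>. (1 / real k)\<^sup>2 * (nM (X k \<omega> - 0))\<^sup>2)"
    by (intro integrable_mult_right integrable_nM_X)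
  then have "integrable P (\<lambda>\<omega>. (nM ((1 / real k) *\<^sub>R X k \<omega>))\<^sup>2)"
    by (simp add: nM_scaleR power_mult_distrib power_divide)
  then have "Var_M M P (\<lambda>\<omega>. (1 / real k) *\<^sub>R X k \<omega>)
      \<le> (\<integral>\<omega>. (nM ((1 / real k) *\<^sub>R X k \<omega> - (1 / real k) *\<^sub>R y))\<^sup>2 \<partial>P)"
    by (rule Var_M_le[OF P.prob_space_axioms e])
  also have "\<dots> = (\<integral>\<omega>. (1 / real k)\<^sup>2 * (nM (X k \<omega> - y))\<^sup>2 \<partial>P)"
    by (simp add: nM_scaleR power_mult_distrib power_divide flip: scaleR_diff_right)
  also have "\<dots> \<le> (1 / real k)\<^sup>2 * total_growth x0 k"
    unfolding y_def by (simp add: integral_distance_le mult_left_mono divide_right_mono)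
  finally have "real k * Var_M M P (\<lambda>\<omega>. (1 / real k) *\<^sub>R X k \<omega>) \<le> real k * ((1 / real k)\<^sup>2 * total_growth x0 k)"
    by (rule mult_left_mono) simp
  then show "real k * Var_M M P (\<lambda>\<omega>. (1 / real k) *\<^sub>R X k \<omega>) \<le> total_growth x0 k / real k"
    using k by (simp add: power2_eq_square)
qed

text \<open>A reference sequence started at \<open>z\<close> with \<open>disp z = v\<close> moves by exactly \<open>- \<alpha> v\<close> in each step.
  With the offset it differs from \<open>- k \<alpha> v\<close> by the constant \<open>g\<close>, which is split off with the
  weights \<open>1 + 1 / sqrt k\<close> and \<open>1 + sqrt k\<close>: divided by \<open>k\<close>, its part vanishes in the limit.\<close>

lemma mean_square_rate:
  assumes "v \<in> range (\<lambda>z. z - T z)"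
  shows "limsup (\<lambda>k. ereal (real k * (\<integral>\<omega>. (nM ((1 / real k) *\<^sub>R X k \<omega> + \<alpha> *\<^sub>R v))\<^sup>2 \<partial>P)))
    \<le> ereal ((\<beta> - \<alpha>\<^sup>2) * (nM v)\<^sup>2)"
proof -
  obtain z where z: "disp z = v"
    using assms unfolding disp_def by blast
  define g where "g = z - offset"
  let ?b = "(\<beta> - \<alpha>\<^sup>2) * (nM v)\<^sup>2"
  let ?U = "\<lambda>k. (1 + 1 / sqrt (real k)) * (total_growth z k / real k)
      + (1 + sqrt (real k)) / real k * (nM g)\<^sup>2"
  have "(\<lambda>k. 1 / sqrt (real k)) \<longlonglongrightarrow> 0" "(\<lambda>k. (1 + sqrt (real k)) / real k) \<longlonglongrightarrow> 0"
    by real_asymp+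
  then have "?U \<longlonglongrightarrow> (1 + 0) * ?b + 0 * (nM g)\<^sup>2"
    by (intro tendsto_intros total_growth_mean_tendsto)
  then have lim: "?U \<longlonglongrightarrow> ?b" by simp
  show ?thesis
  proof (rule limsup_ereal_le_of_eventually_le[OF _ lim])
    fix k :: nat assume k: "k > 0"
    define y where "y = (G ^^ k) z - offset"
    have "(1 / real k) *\<^sub>R x + \<alpha> *\<^sub>R v = (1 / real k) *\<^sub>R ((x - y) + g)" for x
      using k by (simp add: y_def g_def G_pow_attained[OF z] algebra_simps)
    then have "(\<integral>\<omega>. (nM ((1 / real k) *\<^sub>R X k \<omega> + \<alpha> *\<^sub>R v))\<^sup>2 \<partial>P)
        = (\<integral>\<omega>. (1 / real k)\<^sup>2 * (nM ((X k \<omega> - y) + g))\<^sup>2 \<partial>P)"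
      by (simp add: nM_scaleR power_mult_distrib power_divide)
    also have "\<dots> = (1 / real k)\<^sup>2 * (\<integral>\<omega>. (nM ((X k \<omega> - y) + g))\<^sup>2 \<partial>P)"
      by simp
    also have "(\<integral>\<omega>. (nM ((X k \<omega> - y) + g))\<^sup>2 \<partial>P)
        \<le> (\<integral>\<omega>. (1 + 1 / sqrt (real k)) * (nM (X k \<omega> - y))\<^sup>2 + (1 + sqrt (real k)) * (nM g)\<^sup>2 \<partial>P)"
    proof (rule integral_mono)
      show "integrable P (\<lambda>\<omega>. (nM ((X k \<omega> - y) + g))\<^sup>2)"
        using integrable_nM_X[of k "y - g"] by (simp add: algebra_simps)
      show "integrable P (\<lambda>\<omega>. (1 + 1 / sqrt (real k)) * (nM (X k \<omega> - y))\<^sup>2 + (1 + sqrt (real k)) * (nM g)\<^sup>2)"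
        by (intro Bochner_Integration.integrable_add integrable_mult_right integrable_nM_X) simp
      show "(nM ((X k \<omega> - y) + g))\<^sup>2
          \<le> (1 + 1 / sqrt (real k)) * (nM (X k \<omega> - y))\<^sup>2 + (1 + sqrt (real k)) * (nM g)\<^sup>2" for \<omega>
        using nM_sq_add_le[of "1 / sqrt (real k)" "X k \<omega> - y" g] k by simp
    qed
    also have "\<dots> = (1 + 1 / sqrt (real k)) * (\<integral>\<omega>. (nM (X k \<omega> - y))\<^sup>2 \<partial>P) + (1 + sqrt (real k)) * (nM g)\<^sup>2"
      by (simp add: integrable_nM_X P.prob_space)
    also have "\<dots> \<le> (1 + 1 / sqrt (real k)) * total_growth z k + (1 + sqrt (real k)) * (nM g)\<^sup>2"
      unfolding y_def by (intro add_right_mono mult_left_mono integral_distance_le) simp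
    finally have "(\<integral>\<omega>. (nM ((1 / real k) *\<^sub>R X k \<omega> + \<alpha> *\<^sub>R v))\<^sup>2 \<partial>P)
        \<le> (1 / real k)\<^sup>2 * ((1 + 1 / sqrt (real k)) * total_growth z k + (1 + sqrt (real k)) * (nM g)\<^sup>2)"
      by (simp add: mult_left_mono)
    then have "real k * (\<integral>\<omega>. (nM ((1 / real k) *\<^sub>R X k \<omega> + \<alpha> *\<^sub>R v))\<^sup>2 \<partial>P)
        \<le> real k * ((1 / real k)\<^sup>2 * ((1 + 1 / sqrt (real k)) * total_growth z k + (1 + sqrt (real k)) * (nM g)\<^sup>2))"
      by (rule mult_left_mono) simp
    also have "\<dots> = ?U k"
    proof -
      have "real k * ((1 / real k)\<^sup>2 * A) = A / real k" for A
        using k by (simp add: power2_eq_square)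
      then show ?thesis
        by (simp add: add_divide_distrib distrib_right)
    qed
    finally show "real k * (\<integral>\<omega>. (nM ((1 / real k) *\<^sub>R X k \<omega> + \<alpha> *\<^sub>R v))\<^sup>2 \<partial>P) \<le> ?U k" .
  qed
qed

end

theorem theorem5p1:
  fixes H :: "'m::finite \<Rightarrow> 'a::{real_inner, complete_space} set"
    and M :: "'a \<Rightarrow> 'a"
    and T :: "'a \<Rightarrow> 'a"
    and \<theta> \<alpha> \<beta> :: real
    and v x0 :: 'a
    and P :: "'w measure"
    and I :: "nat \<Rightarrow> 'w \<Rightarrow> real ^ 'm"
    and D :: "(real ^ 'm) measure"
  assumes "hilbert_direct_sum H"
    and "hilbert_metric M"
    and "0 < \<theta>" and "\<theta> \<le> 1"
    and "averaged M \<theta> T"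
    and "infimal_displacement M T v"
    and "prob_space P"
    and "prob_space.indep_vars P (\<lambda>_. borel) I UNIV"
    and "\<And>k. distr P borel (I k) = D"
    and "\<And>k \<omega> i. \<omega> \<in> space P \<Longrightarrow> 0 \<le> I k \<omega> $ i \<and> I k \<omega> $ i \<le> 1"
    and "0 < \<alpha>" and "\<alpha> \<le> 1"
    and "(\<integral>s. s \<partial>D) = \<alpha> *\<^sub>R (1 :: real ^ 'm)"
    and "0 < \<beta>" and "\<beta> < \<alpha> / \<theta>"
    and "\<And>u. (\<integral>s. (norm_M M (select H s u))\<^sup>2 \<partial>D) \<le> \<beta> * (norm_M M u)\<^sup>2"
  shows "(v \<in> range (\<lambda>z. z - T z) \<longrightarrow>
            limsup (\<lambda>k. ereal (real k *
               (\<integral>\<omega>. (norm_M M ((1 / real k) *\<^sub>R iterate H \<theta> T I x0 k \<omega> + \<alpha> *\<^sub>R v))\<^sup>2 \<partial>P)))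
            \<le> ereal ((\<beta> - \<alpha>\<^sup>2) * (norm_M M v)\<^sup>2)) \<and>
         limsup (\<lambda>k. ereal (real k *
            Var_M M P (\<lambda>\<omega>. (1 / real k) *\<^sub>R iterate H \<theta> T I x0 k \<omega>)))
         \<le> ereal ((\<beta> - \<alpha>\<^sup>2) * (norm_M M v)\<^sup>2)"
proof -
  interpret P: prob_space P by fact
  have I0: "I 0 \<in> borel_measurable P"
    using assms(8) unfolding P.indep_vars_def2 by blast
  interpret D: prob_space D
    unfolding assms(9)[of 0, symmetric] by (rule P.prob_space_distr[OF I0])
  have sets_D: "sets D = sets borel"
    unfolding assms(9)[of 0, symmetric] by simp
  have "{s :: real ^ 'm. \<forall>i. 0 \<le> s $ i \<and> s $ i \<le> 1} \<in> sets borel"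
  proof (rule borel_closed)
    have "closed {s :: real ^ 'm. 0 \<le> s $ i \<and> s $ i \<le> 1}" for i
      by (intro closed_Collect_conj closed_Collect_le continuous_intros)
    then show "closed {s :: real ^ 'm. \<forall>i. 0 \<le> s $ i \<and> s $ i \<le> 1}"
      by (rule closed_Collect_all)
  qed
  then have cube: "AE s in D. \<forall>i. 0 \<le> s $ i \<and> s $ i \<le> 1"
    unfolding assms(9)[of 0, symmetric] using assms(10)
    by (subst AE_distr_iff[OF I0]) (auto intro!: AE_I2)
  have "\<alpha> * \<theta> \<le> 1"
    using assms(3,4,11,12) by (simp add: mult_le_one)
  interpret random_iteration M \<theta> T v \<alpha> H D \<beta> P I x0
    by unfold_locales (fact assms sets_D cube \<open>\<alpha> * \<theta> \<le> 1\<close>)+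
  show ?thesis
    using mean_square_rate variance_rate by blast
qed

end
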